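(* Let $X$ be the complex manifold of flags of type $(d_1,\ldots,d_k)$ in $\mathbb{C}^N$, let $n=\dim_{\mathbb{C}}X$, and let $E\to X\times X$ and $\eta$ be the vector bundle and the section defined in the context. Then $E$ has rank $n$, $\eta$ is a holomorphic section of $E$, and $\eta$ defines the diagonal $\Delta\subset X\times X$; that is, $\eta$ vanishes to first order along $\Delta$ and is nonzero at every point of $(X\times X)\setminus\Delta$.
   Context: Let $0<d_1<\cdots<d_k=N$ be integers. A flag of type $(d_1,\ldots,d_k)$ is a tuple $\mathbf{F}=(V_1,\ldots,V_k)$ of linear subspaces $V_1\subset V_2\subset\cdots\subset V_k=\mathbb{C}^N$ with $\dim V_i=d_i$. $X$ is the set of all such flags, a complex manifold (homogeneous under $GL(N,\mathbb{C})$) of dimension $n=\sum_{j=1}^{k-1}d_j(d_{j+1}-d_j)$. For $i=1,\ldots,k$ the tautological holomorphic vector bundle is $H_i=\{(\mathbf{F},v)\in X\times\mathbb{C}^N : v\in V_i\}$, and $F_i=(X\times\mathbb{C}^N)/H_i$ is the quotient bundle, with projection $q_i:X\times\mathbb{C}^N\to F_i$. Let $Q_i:F_i\to F_{i+1}$, $v+H_i\mapsto v+H_{i+1}$, be the natural quotient map. Points of $X\times X$ are written $(z,\zeta)$; a subscript $z$ (resp. $\zeta$) on a bundle or morphism denotes pullback from the first (resp. second) factor, e.g. $H_{i,\zeta}$, $F_{i,z}$, $q_{i,z}$. Define a holomorphic section of $\bigoplus_{i=1}^{k-1}F_{i,z}\otimes H_{i,\zeta}^*=\bigoplus_{i=1}^{k-1}\mathrm{Hom}(H_{i,\zeta},F_{i,z})$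 by $\eta(z,\zeta)=\sum_{i=1}^{k-1}\eta_i(z,\zeta)$, where $\eta_i(z,\zeta)v=q_{i,z}(v)$ for $v\in H_{i,\zeta}\subset\mathbb{C}^N$. Define the bundle morphism $$\Phi:\bigoplus_{i=1}^{k-1}\mathrm{Hom}(H_{i,\zeta},F_{i,z})\to\bigoplus_{i=1}^{k-2}\mathrm{Hom}(H_{i,\zeta},F_{i+1,z}),\qquad \Phi\Big(\sum_{i=1}^{k-1}f_i\Big)=\sum_{i=1}^{k-2}\big(f_{i+1}|_{H_{i,\zeta}}-Q_i\circ f_i\big),$$ where $Q_i$ is taken on $F_{i,z}$, and let $E=\ker\Phi$. *)

theory Defs
  imports "HOL-Analysis.Analysis" "HOL-Algebra.Module"
begin

section \<open>Complex manifolds given by holomorphic parametrizations\<close>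

text \<open>\<open>\<complex>\<^sup>I\<close> for a finite index set \<open>I\<close>: functions vanishing outside \<open>I\<close>, with the
  subspace topology of the product topology.\<close>

definition coord_space :: "'i set \<Rightarrow> ('i \<Rightarrow> complex) set" where
  "coord_space I = {x. \<forall>i. i \<notin> I \<longrightarrow> x i = 0}"

text \<open>Holomorphic functions of several variables on an open subset \<open>D\<close> of \<open>\<complex>\<^sup>I\<close>: continuous and
  holomorphic in each variable separately (Osgood).\<close>

definition holomorphic_in_coords ::
    "'i set \<Rightarrow> ('i \<Rightarrow> complex) set \<Rightarrow> (('i \<Rightarrow> complex) \<Rightarrow> complex) \<Rightarrow> bool" where
  "holomorphic_in_coords I D f \<longleftrightarrow>
     openin (top_of_set (coord_space I)) D \<and> continuous_on D f \<and>
     (\<forall>x\<in>D. \<forall>i\<in>I. (\<lambda>t. f (x(i := t))) holomorphic_on {t. x(i := t) \<in> D})"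

definition partial_deriv ::
    "'i \<Rightarrow> (('i \<Rightarrow> complex) \<Rightarrow> complex) \<Rightarrow> ('i \<Rightarrow> complex) \<Rightarrow> complex" where
  "partial_deriv i f x = deriv (\<lambda>t. f (x(i := t))) (x i)"

text \<open>A manifold structure is recorded by its points, the index set of its coordinates, and an atlas
  of inverse charts \<open>(D, \<psi>)\<close>, with \<open>D\<close> open in \<open>\<complex>\<^sup>I\<close> and \<open>\<psi>\<close> injective from \<open>D\<close> into the points.\<close>

record ('i, 'p) manifold =
  points :: "'p set"
  coords :: "'i set"
  params :: "(('i \<Rightarrow> complex) set \<times> (('i \<Rightarrow> complex) \<Rightarrow> 'p)) set"

definition mfd_dim :: "('i, 'p) manifold \<Rightarrow> nat" where
  "mfd_dim M = card (coords M)"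

definition local_param ::
    "('i, 'p) manifold \<Rightarrow> ('i \<Rightarrow> complex) set \<Rightarrow> (('i \<Rightarrow> complex) \<Rightarrow> 'p) \<Rightarrow>
     ('i \<Rightarrow> complex) \<Rightarrow> 'p \<Rightarrow> bool" where
  "local_param M D \<psi> x p \<longleftrightarrow>
     (\<exists>D0. (D0, \<psi>) \<in> params M \<and> D \<subseteq> D0) \<and> openin (top_of_set (coord_space (coords M))) D \<and>
     x \<in> D \<and> \<psi> x = p"

text \<open>Openness and holomorphy are local and are tested around each point in some chart at that
  point; as the charts of an atlas are compatible, the choice of the chart does not matter.\<close>

definition mfd_open :: "('i, 'p) manifold \<Rightarrow> 'p set \<Rightarrow> bool" where
  "mfd_open M W \<longleftrightarrow> W \<subseteq> points M \<and> (\<forall>p\<in>W. \<exists>D \<psi> x. local_param M D \<psi> x p \<and> \<psi> ` D \<subseteq> W)"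

definition mfd_holomorphic :: "('i, 'p) manifold \<Rightarrow> 'p set \<Rightarrow> ('p \<Rightarrow> complex) \<Rightarrow> bool" where
  "mfd_holomorphic M W f \<longleftrightarrow>
     mfd_open M W \<and>
     (\<forall>p\<in>W. \<exists>D \<psi> x. local_param M D \<psi> x p \<and> \<psi> ` D \<subseteq> W \<and>
        holomorphic_in_coords (coords M) D (f \<circ> \<psi>))"

definition mfd_holomorphic_vec :: "('i, 'p) manifold \<Rightarrow> 'p set \<Rightarrow> ('p \<Rightarrow> complex ^ 'n) \<Rightarrow> bool" where
  "mfd_holomorphic_vec M W f \<longleftrightarrow> (\<forall>i. mfd_holomorphic M W (\<lambda>p. f p $ i))"

definition mfd_prod :: "('i, 'p) manifold \<Rightarrow> ('j, 'q) manifold \<Rightarrow> ('i + 'j, 'p \<times> 'q) manifold" where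
  "mfd_prod M M' =
     \<lparr>points = points M \<times> points M',
      coords = coords M <+> coords M',
      params = {({x. x \<circ> Inl \<in> D \<and> x \<circ> Inr \<in> D'}, \<lambda>x. (\<psi> (x \<circ> Inl), \<psi>' (x \<circ> Inr))) |D \<psi> D' \<psi>'.
        (D, \<psi>) \<in> params M \<and> (D', \<psi>') \<in> params M'}\<rparr>"


section \<open>Holomorphic vector bundles\<close>

text \<open>Complex vector spaces with explicit carriers are modules over the field of complex numbers.
  The ring fields \<open>mult\<close> and \<open>one\<close> of the module record play no role.\<close>

definition complex_field :: "complex ring" where
  "complex_field = \<lparr>carrier = UNIV, mult = (*), one = 1, zero = 0, add = (+)\<rparr>"

definition is_basis :: "(complex, 'f) module \<Rightarrow> 'j set \<Rightarrow> ('j \<Rightarrow> 'f) \<Rightarrow> bool" where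
  "is_basis E J e \<longleftrightarrow> e \<in> J \<rightarrow> carrier E \<and>
     (\<forall>v\<in>carrier E. \<exists>!c. c \<in> extensional J \<and> v = (\<Oplus>\<^bsub>E\<^esub>j\<in>J. c j \<odot>\<^bsub>E\<^esub> e j))"

text \<open>A bundle is recorded by its fibres and its holomorphic sections over open sets.\<close>

record ('p, 'f) vbundle =
  fibre :: "'p \<Rightarrow> (complex, 'f) module"
  hol_section :: "'p set \<Rightarrow> ('p \<Rightarrow> 'f) \<Rightarrow> bool"

definition local_frame :: "('p, 'f) vbundle \<Rightarrow> nat \<Rightarrow> 'p set \<Rightarrow> (nat \<Rightarrow> 'p \<Rightarrow> 'f) \<Rightarrow> bool" where
  "local_frame B r W e \<longleftrightarrow>
     (\<forall>j<r. hol_section B W (e j)) \<and> (\<forall>p\<in>W. is_basis (fibre B p) {..<r} (\<lambda>j. e j p))"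

definition vector_bundle_of_rank :: "('i, 'p) manifold \<Rightarrow> ('p, 'f) vbundle \<Rightarrow> nat \<Rightarrow> bool" where
  "vector_bundle_of_rank M B r \<longleftrightarrow>
     (\<forall>p\<in>points M. module complex_field (fibre B p)) \<and>
     (\<forall>p\<in>points M. \<exists>W e. mfd_open M W \<and> p \<in> W \<and> local_frame B r W e)"

text \<open>First order vanishing along a submanifold \<open>S\<close> whose codimension is the rank \<open>r\<close> of the bundle:
  the section vanishes on \<open>S\<close>, and at each point of \<open>S\<close> the differentials of its \<open>r\<close> coefficient
  functions in a local holomorphic frame are linearly independent.\<close>

definition vanishes_to_first_order ::
    "('i, 'p) manifold \<Rightarrow> ('p, 'f) vbundle \<Rightarrow> nat \<Rightarrow> ('p \<Rightarrow> 'f) \<Rightarrow> 'p set \<Rightarrow> bool" where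
  "vanishes_to_first_order M B r s S \<longleftrightarrow>
     (\<forall>p\<in>S. s p = \<zero>\<^bsub>fibre B p\<^esub> \<and>
       (\<exists>W e a D \<psi> x.
          mfd_open M W \<and> local_frame B r W e \<and>
          (\<forall>q\<in>W. s q = (\<Oplus>\<^bsub>fibre B q\<^esub>j\<in>{..<r}. a j q \<odot>\<^bsub>fibre B q\<^esub> e j q)) \<and>
          local_param M D \<psi> x p \<and> \<psi> ` D \<subseteq> W \<and>
          (\<forall>j<r. holomorphic_in_coords (coords M) D (a j \<circ> \<psi>)) \<and>
          (\<forall>c :: nat \<Rightarrow> complex.
             (\<forall>i\<in>coords M. (\<Sum>j<r. c j * partial_deriv i (a j \<circ> \<psi>) x) = 0) \<longrightarrow> (\<forall>j<r. c j = 0))))"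


section \<open>The bundles Hom(H, F) for a subbundle H and a quotient F of a trivial bundle\<close>

definition coset :: "(complex ^ 'n) set \<Rightarrow> complex ^ 'n \<Rightarrow> (complex ^ 'n) set" where
  "coset V v = (\<lambda>w. v + w) ` V"

definition quotient_space :: "(complex ^ 'n) set \<Rightarrow> (complex, (complex ^ 'n) set) module" where
  "quotient_space V =
     \<lparr>carrier = range (coset V), mult = undefined, one = undefined,
      zero = V, add = (\<lambda>A B. {a + b |a b. a \<in> A \<and> b \<in> B}),
      smult = (\<lambda>c A. {c *s a + w |a w. a \<in> A \<and> w \<in> V})\<rparr>"

text \<open>The linear maps \<open>H \<rightarrow> M\<close> on a subspace \<open>H\<close>, as functions that are \<open>undefined\<close> off \<open>H\<close>.\<close>

definition hom_space ::
    "(complex ^ 'n) set \<Rightarrow> (complex, 'f) module \<Rightarrow> (complex, complex ^ 'n \<Rightarrow> 'f) module" where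
  "hom_space H M =
     \<lparr>carrier = {f \<in> H \<rightarrow>\<^sub>E carrier M.
        (\<forall>u\<in>H. \<forall>v\<in>H. f (u + v) = f u \<oplus>\<^bsub>M\<^esub> f v) \<and> (\<forall>c. \<forall>u\<in>H. f (c *s u) = c \<odot>\<^bsub>M\<^esub> f u)},
      mult = undefined, one = undefined,
      zero = (\<lambda>u\<in>H. \<zero>\<^bsub>M\<^esub>), add = (\<lambda>f g. \<lambda>u\<in>H. f u \<oplus>\<^bsub>M\<^esub> g u),
      smult = (\<lambda>c f. \<lambda>u\<in>H. c \<odot>\<^bsub>M\<^esub> f u)\<rparr>"

definition direct_sum :: "'j set \<Rightarrow> ('j \<Rightarrow> (complex, 'f) module) \<Rightarrow> (complex, 'j \<Rightarrow> 'f) module" where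
  "direct_sum J M =
     \<lparr>carrier = (\<Pi>\<^sub>E j\<in>J. carrier (M j)), mult = undefined, one = undefined,
      zero = (\<lambda>j\<in>J. \<zero>\<^bsub>M j\<^esub>), add = (\<lambda>f g. \<lambda>j\<in>J. f j \<oplus>\<^bsub>M j\<^esub> g j),
      smult = (\<lambda>c f. \<lambda>j\<in>J. c \<odot>\<^bsub>M j\<^esub> f j)\<rparr>"

text \<open>A section of the quotient of the trivial bundle by the subbundle with fibres \<open>V p\<close> is holomorphic
  iff it lifts locally to a holomorphic vector-valued function.\<close>

definition hol_quotient_section ::
    "('i, 'p) manifold \<Rightarrow> 'p set \<Rightarrow> ('p \<Rightarrow> (complex ^ 'n) set) \<Rightarrow> ('p \<Rightarrow> (complex ^ 'n) set) \<Rightarrow> bool" where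
  "hol_quotient_section M W V t \<longleftrightarrow>
     mfd_open M W \<and>
     (\<forall>p\<in>W. \<exists>W' b. mfd_open M W' \<and> p \<in> W' \<and> W' \<subseteq> W \<and> mfd_holomorphic_vec M W' b \<and>
        (\<forall>q\<in>W'. t q = coset (V q) (b q)))"

definition hol_subspace_frame ::
    "('i, 'p) manifold \<Rightarrow> 'p set \<Rightarrow> ('p \<Rightarrow> (complex ^ 'n) set) \<Rightarrow> nat \<Rightarrow> (nat \<Rightarrow> 'p \<Rightarrow> complex ^ 'n) \<Rightarrow> bool" where
  "hol_subspace_frame M W H m h \<longleftrightarrow>
     (\<forall>j<m. mfd_holomorphic_vec M W (h j)) \<and>
     (\<forall>q\<in>W. inj_on (\<lambda>j. h j q) {..<m} \<and> vec.independent ((\<lambda>j. h j q) ` {..<m}) \<and>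
        vec.span ((\<lambda>j. h j q) ` {..<m}) = H q)"

text \<open>A section of Hom(H, F) is holomorphic iff locally it maps a holomorphic frame of H to
  holomorphic sections of F.\<close>

definition hol_hom_section ::
    "('i, 'p) manifold \<Rightarrow> 'p set \<Rightarrow> ('p \<Rightarrow> (complex ^ 'n) set) \<Rightarrow> ('p \<Rightarrow> (complex ^ 'n) set) \<Rightarrow>
     ('p \<Rightarrow> complex ^ 'n \<Rightarrow> (complex ^ 'n) set) \<Rightarrow> bool" where
  "hol_hom_section M W H V f \<longleftrightarrow>
     mfd_open M W \<and> (\<forall>p\<in>W. f p \<in> carrier (hom_space (H p) (quotient_space (V p)))) \<and>
     (\<forall>p\<in>W. \<exists>W' m h. mfd_open M W' \<and> p \<in> W' \<and> W' \<subseteq> W \<and> hol_subspace_frame M W' H m h \<and>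
        (\<forall>j<m. hol_quotient_section M W' V (\<lambda>q. f q (h j q))))"


section \<open>The flag manifold\<close>

type_synonym 'n flag = "nat \<Rightarrow> (complex ^ 'n) set"

definition flags :: "nat \<Rightarrow> (nat \<Rightarrow> nat) \<Rightarrow> 'n::finite flag set" where
  "flags k d = {V \<in> extensional {1..k}.
     (\<forall>i\<in>{1..k}. vec.subspace (V i) \<and> vec.dim (V i) = d i) \<and>
     (\<forall>i\<in>{1..<k}. V i \<subseteq> V (i + 1)) \<and> V k = UNIV}"

text \<open>The charts are the big cells \<open>g \<cdot> U\<^sup>- \<cdot> F\<^sub>0\<close>: \<open>g\<close> is an invertible matrix with columns
  \<open>b\<^sub>1, \<dots>, b\<^sub>N\<close>, \<open>U\<^sup>-\<close> consists of the unipotent block lower triangular matrices, and \<open>F\<^sub>0\<close> is the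
  coordinate flag. The coordinates are the entries \<open>x (r, j)\<close> (row \<open>r\<close>, column \<open>j\<close>) below the
  diagonal blocks.\<close>

definition flag_coords :: "nat \<Rightarrow> (nat \<Rightarrow> nat) \<Rightarrow> (nat \<times> nat) set" where
  "flag_coords k d = (\<Union>i\<in>{1..<k}. {d i <.. d (i + 1)} \<times> {1..d i})"

definition adapted_vector ::
    "nat \<Rightarrow> (nat \<Rightarrow> nat) \<Rightarrow> (nat \<Rightarrow> complex ^ 'n) \<Rightarrow> (nat \<times> nat \<Rightarrow> complex) \<Rightarrow> nat \<Rightarrow> complex ^ 'n" where
  "adapted_vector k d b x j = b j + (\<Sum>r | (r, j) \<in> flag_coords k d. x (r, j) *s b r)"

definition flag_param ::
    "nat \<Rightarrow> (nat \<Rightarrow> nat) \<Rightarrow> (nat \<Rightarrow> complex ^ 'n) \<Rightarrow> (nat \<times> nat \<Rightarrow> complex) \<Rightarrow> 'n::finite flag" where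
  "flag_param k d b x = (\<lambda>i\<in>{1..k}. vec.span (adapted_vector k d b x ` {1..d i}))"

definition flag_manifold :: "nat \<Rightarrow> (nat \<Rightarrow> nat) \<Rightarrow> (nat \<times> nat, 'n::finite flag) manifold" where
  "flag_manifold k d =
     \<lparr>points = flags k d,
      coords = flag_coords k d,
      params = {(coord_space (flag_coords k d), flag_param k d b) |b.
        inj_on b {1..CARD('n)} \<and> vec.independent (b ` {1..CARD('n)})}\<rparr>"

lemma mfd_dim_flag_manifold:
  assumes "\<forall>i\<in>{1..<k}. d i < d (i + 1)"
  shows "mfd_dim (flag_manifold k d :: (nat \<times> nat, 'n::finite flag) manifold) =
           (\<Sum>j\<in>{1..<k}. d j * (d (j + 1) - d j))"
proof -
  have mono: "d i \<le> d j" if "1 \<le> i" "i \<le> j" "j \<le> k" for i j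
    using that(2,3)
  proof (induction j rule: dec_induct)
    case (step j)
    then show ?case using assms that(1) by (force dest!: bspec[of _ _ j])
  qed simp
  have disj: "({d i <.. d (i + 1)} \<times> {1..d i}) \<inter> ({d j <.. d (j + 1)} \<times> {1..d j}) = {}"
    if "1 \<le> i" "i < j" "j < k" for i j
    using mono[of "i + 1" j] that by auto
  have "card (flag_coords k d) = (\<Sum>i\<in>{1..<k}. card ({d i <.. d (i + 1)} \<times> {1..d i}))"
    unfolding flag_coords_def
  proof (rule card_UN_disjoint)
    show "\<forall>i\<in>{1..<k}. \<forall>j\<in>{1..<k}. i \<noteq> j \<longrightarrow>
        ({d i <.. d (i + 1)} \<times> {1..d i}) \<inter> ({d j <.. d (j + 1)} \<times> {1..d j}) = {}"
    proof (intro ballI impI)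
      fix i j assume "i \<in> {1..<k}" "j \<in> {1..<k}" "i \<noteq> j"
      then show "({d i <.. d (i + 1)} \<times> {1..d i}) \<inter> ({d j <.. d (j + 1)} \<times> {1..d j}) = {}"
        using disj[of i j] disj[of j i] by (cases i j rule: linorder_cases) auto
    qed
  qed auto
  also have "\<dots> = (\<Sum>j\<in>{1..<k}. d j * (d (j + 1) - d j))"
    by (intro sum.cong) (simp_all add: card_cartesian_product mult.commute)
  finally show ?thesis
    by (simp add: mfd_dim_def flag_manifold_def)
qed


section \<open>The bundle E and the section \<open>\<eta>\<close>\<close>

text \<open>Points of \<open>X \<times> X\<close> are pairs \<open>p = (z, \<zeta>)\<close>; the fibre at \<open>z\<close> of \<open>H\<^sub>i\<close> is \<open>z i\<close>, and that of \<open>F\<^sub>i\<close> is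
  \<open>quotient_space (z i)\<close>.\<close>

definition hom_sum :: "nat \<Rightarrow> 'n flag \<times> 'n flag \<Rightarrow> (complex, nat \<Rightarrow> complex ^ 'n \<Rightarrow> (complex ^ 'n) set) module" where
  "hom_sum k = (\<lambda>(z, \<zeta>). direct_sum {1..<k} (\<lambda>i. hom_space (\<zeta> i) (quotient_space (z i))))"

definition hom_sum_shifted :: "nat \<Rightarrow> 'n flag \<times> 'n flag \<Rightarrow> (complex, nat \<Rightarrow> complex ^ 'n \<Rightarrow> (complex ^ 'n) set) module" where
  "hom_sum_shifted k =
     (\<lambda>(z, \<zeta>). direct_sum {1..<k - 1} (\<lambda>i. hom_space (\<zeta> i) (quotient_space (z (i + 1)))))"

text \<open>The map \<open>\<complex>\<^sup>N / V \<rightarrow> \<complex>\<^sup>N / V'\<close> induced by the identity, for \<open>V \<subseteq> V'\<close>.\<close>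

definition quotient_map :: "(complex ^ 'n) set \<Rightarrow> (complex ^ 'n) set \<Rightarrow> (complex ^ 'n) set" where
  "quotient_map V' A = (\<Union>a\<in>A. coset V' a)"

definition Phi ::
    "nat \<Rightarrow> 'n flag \<times> 'n flag \<Rightarrow> (nat \<Rightarrow> complex ^ 'n \<Rightarrow> (complex ^ 'n) set) \<Rightarrow>
     (nat \<Rightarrow> complex ^ 'n \<Rightarrow> (complex ^ 'n) set)" where
  "Phi k = (\<lambda>(z, \<zeta>) f. \<lambda>i\<in>{1..<k - 1}.
     restrict (f (i + 1)) (\<zeta> i)
       \<ominus>\<^bsub>hom_space (\<zeta> i) (quotient_space (z (i + 1)))\<^esub>
     compose (\<zeta> i) (quotient_map (z (i + 1))) (f i))"

definition E_fibre :: "nat \<Rightarrow> 'n flag \<times> 'n flag \<Rightarrow> (complex, nat \<Rightarrow> complex ^ 'n \<Rightarrow> (complex ^ 'n) set) module" where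
  "E_fibre k p = (hom_sum k p)
     \<lparr>carrier := {f \<in> carrier (hom_sum k p). Phi k p f = \<zero>\<^bsub>hom_sum_shifted k p\<^esub>}\<rparr>"

text \<open>As a subbundle, E has as holomorphic sections the holomorphic sections of the direct sum of the
  Hom bundles with values in E.\<close>

definition E_bundle ::
    "nat \<Rightarrow> (nat \<Rightarrow> nat) \<Rightarrow> ('n::finite flag \<times> 'n flag, nat \<Rightarrow> complex ^ 'n \<Rightarrow> (complex ^ 'n) set) vbundle" where
  "E_bundle k d =
     (let XX = mfd_prod (flag_manifold k d) (flag_manifold k d) in
      \<lparr>fibre = E_fibre k,
       hol_section = (\<lambda>W s. mfd_open XX W \<and> (\<forall>p\<in>W. s p \<in> carrier (E_fibre k p)) \<and>
         (\<forall>i\<in>{1..<k}. hol_hom_section XX W (\<lambda>(z, \<zeta>). \<zeta> i) (\<lambda>(z, \<zeta>). z i) (\<lambda>p. s p i)))\<rparr>)"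

definition eta :: "nat \<Rightarrow> 'n flag \<times> 'n flag \<Rightarrow> nat \<Rightarrow> complex ^ 'n \<Rightarrow> (complex ^ 'n) set" where
  "eta k = (\<lambda>(z, \<zeta>). \<lambda>i\<in>{1..<k}. \<lambda>v\<in>\<zeta> i. coset (z i) v)"

end

theory Submission
  imports Defs
begin

text \<open>Every matrix \<open>T\<close> induces the maps \<open>v \<mapsto> T v + z\<^sub>i\<close> from \<open>\<zeta>\<^sub>i\<close> to \<open>\<complex>\<^sup>N / z\<^sub>i\<close>, and these lie in the kernel of \<open>\<Phi>\<close>.
  Conversely, an element of the kernel is determined by its values on a basis of \<open>\<complex>\<^sup>N\<close> adapted to \<open>\<zeta>\<close>,
  each taken at the first step containing the basis vector; lifting these values gives a matrix. So the
  fibre of E at \<open>(z, \<zeta>)\<close> is \<open>End(\<complex>\<^sup>N) / {T. \<forall>i. T \<zeta>\<^sub>i \<subseteq> z\<^sub>i}\<close>, and \<open>\<eta>\<close> is the class of the identity.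

  In a chart, \<open>\<zeta>\<close> has the adapted basis \<open>w\<^sub>j = b'\<^sub>j + \<Sum>\<^sub>r y\<^sub>r\<^sub>j b'\<^sub>r\<close>, and the constant vectors \<open>b\<^sub>r\<close> with
  \<open>r > d\<^sub>i\<close> induce a basis of \<open>\<complex>\<^sup>N / z\<^sub>i\<close>. The matrices sending \<open>w\<^sub>j\<close> to \<open>b\<^sub>r\<close> and the other basis vectors
  to 0, one for each coordinate \<open>(r, j)\<close>, therefore give a holomorphic frame of E. On a chart with
  \<open>b = b'\<close> the coefficients of \<open>\<eta>\<close> in this frame are the functions \<open>y\<^sub>r\<^sub>j - x\<^sub>r\<^sub>j\<close>, whose differentials are
  independent.\<close>

section \<open>Finite families of vectors\<close>

text \<open>Independence is stated for indexed families rather than for sets, so that coefficients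
  stay attached to their indices and repeated vectors are excluded.\<close>

definition independent_family :: "'j set \<Rightarrow> ('j \<Rightarrow> complex ^ 'n) \<Rightarrow> bool" where
  "independent_family J v \<longleftrightarrow> (\<forall>c. (\<Sum>j\<in>J. c j *s v j) = 0 \<longrightarrow> (\<forall>j\<in>J. c j = 0))"

lemma independent_familyD:
  "independent_family J v \<Longrightarrow> (\<Sum>j\<in>J. c j *s v j) = 0 \<Longrightarrow> j \<in> J \<Longrightarrow> c j = 0"
  by (simp add: independent_family_def)

lemma span_family:
  fixes v :: "'j \<Rightarrow> complex ^ 'n::finite"
  assumes "finite J"
  shows "vec.span (v ` J) = range (\<lambda>c. \<Sum>j\<in>J. c j *s v j)"
proof
  have sub: "vec.subspace (range (\<lambda>c. \<Sum>j\<in>J. c j *s v j))"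
  proof (rule vec.subspaceI)
    show "0 \<in> range (\<lambda>c. \<Sum>j\<in>J. c j *s v j)"
      by (rule range_eqI[where x = "\<lambda>_. 0"]) simp
  next
    fix x y assume "x \<in> range (\<lambda>c. \<Sum>j\<in>J. c j *s v j)" "y \<in> range (\<lambda>c. \<Sum>j\<in>J. c j *s v j)"
    then obtain a b where "x = (\<Sum>j\<in>J. a j *s v j)" "y = (\<Sum>j\<in>J. b j *s v j)" by auto
    then have "x + y = (\<Sum>j\<in>J. (a j + b j) *s v j)"
      by (simp add: vec.scale_left_distrib sum.distrib)
    then show "x + y \<in> range (\<lambda>c. \<Sum>j\<in>J. c j *s v j)"
      by (rule range_eqI[where x = "\<lambda>j. a j + b j"])
  next
    fix c x assume "x \<in> range (\<lambda>c. \<Sum>j\<in>J. c j *s v j)"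
    then obtain a where "x = (\<Sum>j\<in>J. a j *s v j)" by auto
    then have "c *s x = (\<Sum>j\<in>J. (c * a j) *s v j)"
      by (simp add: vec.scale_sum_right)
    then show "c *s x \<in> range (\<lambda>c. \<Sum>j\<in>J. c j *s v j)"
      by (rule range_eqI[where x = "\<lambda>j. c * a j"])
  qed
  have "v j \<in> range (\<lambda>c. \<Sum>j\<in>J. c j *s v j)" if "j \<in> J" for j
    by (rule range_eqI[where x = "\<lambda>i. if i = j then 1 else 0"])
      (simp add: if_distrib[of "\<lambda>c. c *s _"] sum.delta assms that cong: if_cong)
  then show "vec.span (v ` J) \<subseteq> range (\<lambda>c. \<Sum>j\<in>J. c j *s v j)"
    by (intro vec.span_minimal sub) auto
  show "range (\<lambda>c. \<Sum>j\<in>J. c j *s v j) \<subseteq> vec.span (v ` J)"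
    by (rule image_subsetI, rule vec.span_sum, rule vec.span_scale, rule vec.span_base) simp
qed

text \<open>A repetition \<open>v i = v j\<close> would give a relation with coefficients 1 and -1,
  so an independent family is injective. Relations of the family and of its image then correspond by
  reindexing.\<close>

lemma independent_family_iff:
  fixes v :: "'j \<Rightarrow> complex ^ 'n::finite"
  assumes "finite J"
  shows "independent_family J v \<longleftrightarrow> inj_on v J \<and> vec.independent (v ` J)"
proof
  assume ind: "independent_family J v"
  have inj: "inj_on v J"
  proof (rule inj_onI, rule ccontr)
    fix i j assume ij: "i \<in> J" "j \<in> J" "v i = v j" "i \<noteq> j"
    define c where "c = (\<lambda>m. if m = i then 1 else 0 :: complex)"
    define c' where "c' = (\<lambda>m. if m = j then 1 else 0 :: complex)"
    have "(\<Sum>m\<in>J. c m *s v m) = v i" "(\<Sum>m\<in>J. c' m *s v m) = v j"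
      using ij by (simp_all add: c_def c'_def if_distrib[of "\<lambda>c. c *s _"] sum.delta assms cong: if_cong)
    then have "(\<Sum>m\<in>J. (c m - c' m) *s v m) = 0"
      using ij by (simp add: vec.scale_left_diff_distrib sum_subtractf)
    from independent_familyD[OF ind this ij(1)] show False
      using ij by (simp add: c_def c'_def)
  qed
  have "vec.independent (v ` J)"
  proof (rule vec.independent_if_scalars_zero)
    fix f x assume s: "(\<Sum>x\<in>v ` J. f x *s x) = 0" and x: "x \<in> v ` J"
    then show "f x = 0"
      using independent_familyD[OF ind, of "f \<circ> v"] by (auto simp: sum.reindex inj)
  qed (simp add: assms)
  with inj show "inj_on v J \<and> vec.independent (v ` J)" ..
next
  assume *: "inj_on v J \<and> vec.independent (v ` J)"
  show "independent_family J v"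
    unfolding independent_family_def
  proof (intro allI impI ballI)
    fix c j assume s: "(\<Sum>j\<in>J. c j *s v j) = 0" and j: "j \<in> J"
    have "(\<Sum>x\<in>v ` J. c (the_inv_into J v x) *s x) = 0"
      using * s by (simp add: sum.reindex the_inv_into_f_f)
    then have "c (the_inv_into J v (v j)) = 0"
      using * j assms vec.independentD[of "v ` J" "v ` J" "\<lambda>x. c (the_inv_into J v x)" "v j"] by blast
    then show "c j = 0" using * j by (simp add: the_inv_into_f_f)
  qed
qed

lemma independent_family_subset:
  assumes "independent_family J v" "finite J" "I \<subseteq> J"
  shows "independent_family I v"
  unfolding independent_family_def
proof (intro allI impI ballI)
  fix c i assume s: "(\<Sum>j\<in>I. c j *s v j) = 0" and i: "i \<in> I"
  have "(\<Sum>j\<in>J. (if j \<in> I then c j else 0) *s v j) = (\<Sum>j\<in>I. c j *s v j)"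
    using assms(2,3) by (intro sum.mono_neutral_cong_right) auto
  with independent_familyD[OF assms(1), of "\<lambda>j. if j \<in> I then c j else 0" i] s i assms(3)
  show "c i = 0" by auto
qed

lemma independent_family_cong:
  "(\<And>j. j \<in> J \<Longrightarrow> u j = v j) \<Longrightarrow> independent_family J u \<longleftrightarrow> independent_family J v"
  by (simp add: independent_family_def)

lemma dim_span_family:
  fixes v :: "'j \<Rightarrow> complex ^ 'n::finite"
  assumes "independent_family J v" "finite J"
  shows "vec.dim (vec.span (v ` J)) = card J"
  using assms
  by (metis card_image independent_family_iff vec.dim_span_eq_card_independent)

lemma span_family_UNIV:
  fixes v :: "'j \<Rightarrow> complex ^ 'n::finite"
  assumes "independent_family J v" "finite J" "card J = CARD('n)"
  shows "vec.span (v ` J) = UNIV"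
proof -
  have "vec.dim (vec.span (v ` J)) = vec.dim (UNIV :: (complex ^ 'n) set)"
    using dim_span_family[OF assms(1,2)] assms(3) by (metis vec_dim_card)
  then show ?thesis by (intro vec.subspace_dim_equal) auto
qed

lemma matrix_on_family:
  fixes v :: "'j \<Rightarrow> complex ^ 'n::finite" and t :: "'j \<Rightarrow> complex ^ 'n"
  assumes "independent_family J v" "finite J"
  obtains A :: "complex ^ 'n ^ 'n" where "\<And>j. j \<in> J \<Longrightarrow> A *v v j = t j"
proof -
  have inj: "inj_on v J" and ind: "vec.independent (v ` J)"
    using assms by (auto simp: independent_family_iff)
  obtain g where g: "Vector_Spaces.linear (*s) (*s) g" "\<forall>x\<in>v ` J. g x = t (the_inv_into J v x)"
    using vec.linear_independent_extend[OF ind, of "\<lambda>x. t (the_inv_into J v x)"] by blast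
  have "matrix g *v v j = t j" if "j \<in> J" for j
    using g inj that by (simp add: matrix_works the_inv_into_f_f)
  then show thesis by (rule that)
qed

text \<open>The given vectors extend to a basis \<open>B\<close> of \<open>V\<close>, and the new
  elements of \<open>B\<close> are numbered from \<open>m + 1\<close> to \<open>m'\<close>. The old
  vectors keep their indices, so bases of the steps of a flag can be nested.\<close>

lemma extend_independent_family:
  fixes v :: "nat \<Rightarrow> complex ^ 'n::finite"
  assumes v: "independent_family {1..m} v" and sub: "vec.span (v ` {1..m}) \<subseteq> V"
    and V: "vec.subspace V" "vec.dim V = m'"
  shows "m \<le> m' \<and> (\<exists>u. (\<forall>j\<in>{1..m}. u j = v j) \<and> independent_family {1..m'} u \<and>
    vec.span (u ` {1..m'}) = V)"
proof -
  have inj: "inj_on v {1..m}" and ind: "vec.independent (v ` {1..m})"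
    using v by (auto simp: independent_family_iff)
  have "v ` {1..m} \<subseteq> V" using sub vec.span_superset by blast
  then obtain B where B: "v ` {1..m} \<subseteq> B" "B \<subseteq> V" "vec.independent B" "V \<subseteq> vec.span B"
    using vec.maximal_independent_subset_extend ind by blast
  have cB: "card B = m'" and finB: "finite B"
    using B V vec.basis_card_eq_dim vec.finiteI_independent by auto
  have cv: "card (v ` {1..m}) = m" using inj by (simp add: card_image)
  then have le: "m \<le> m'" using B(1) cB finB card_mono by metis
  have "card (B - v ` {1..m}) = card {m+1..m'}"
    using B(1) cB cv by (simp add: card_Diff_subset)
  then obtain h where h: "bij_betw h {m+1..m'} (B - v ` {1..m})"
    using finite_same_card_bij finB by (metis finite_Diff finite_atLeastAtMost)
  define u where "u = (\<lambda>j. if j \<le> m then v j else h j)"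
  have range_split: "{1..m'} = {1..m} \<union> {m+1..m'}" using le by auto
  have im1: "u ` {1..m} = v ` {1..m}" by (auto simp: u_def)
  have im2: "u ` {m+1..m'} = B - v ` {1..m}"
  proof -
    have "u ` {m+1..m'} = h ` {m+1..m'}"
      by (rule image_cong) (auto simp: u_def)
    then show ?thesis using h by (simp add: bij_betw_def)
  qed
  have im: "u ` {1..m'} = B"
    using B(1) unfolding range_split image_Un im1 im2 by blast
  have "inj_on u {1..m'}" using im cB by (intro eq_card_imp_inj_on) auto
  then have "independent_family {1..m'} u" using im B(3) by (simp add: independent_family_iff)
  moreover have "vec.span (u ` {1..m'}) = V"
    unfolding im using B V(1) by (intro equalityI vec.span_minimal) auto
  moreover have "\<forall>j\<in>{1..m}. u j = v j" by (simp add: u_def)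
  ultimately show ?thesis using le by blast
qed


section \<open>Modules parametrized by a complex vector space\<close>

lemma cring_complex_field: "cring complex_field"
  by (rule cringI, rule abelian_groupI)
    (auto simp: complex_field_def algebra_simps intro!: comm_monoidI exI[where x = "- _"])

text \<open>A module with explicit carrier is presented as the image of a vector space on a whole
  type. Module axioms, finite sums and bases can then be checked on representatives, modulo the
  kernel of \<open>\<phi>\<close>.\<close>

locale module_image = vector_space sc
  for sc :: "complex \<Rightarrow> 'v::ab_group_add \<Rightarrow> 'v" +
  fixes \<phi> :: "'v \<Rightarrow> 'f" and M :: "(complex, 'f) module"
  assumes carrier_image: "carrier M = range \<phi>"
    and zero_image: "\<zero>\<^bsub>M\<^esub> = \<phi> 0"
    and add_image: "\<phi> a \<oplus>\<^bsub>M\<^esub> \<phi> b = \<phi> (a + b)"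
    and smult_image: "c \<odot>\<^bsub>M\<^esub> \<phi> a = \<phi> (sc c a)"
begin

lemma abelian_group_image: "abelian_group M"
proof (rule abelian_groupI)
  fix x assume "x \<in> carrier M"
  then obtain a where "x = \<phi> a" by (auto simp: carrier_image)
  then have "\<phi> (- a) \<oplus>\<^bsub>M\<^esub> x = \<zero>\<^bsub>M\<^esub>" by (simp add: add_image zero_image)
  then show "\<exists>y\<in>carrier M. y \<oplus>\<^bsub>M\<^esub> x = \<zero>\<^bsub>M\<^esub>" by (auto simp: carrier_image)
qed (auto simp: carrier_image add_image zero_image ac_simps)

lemma module_complex_field: "module complex_field M"
  by (rule moduleI[OF cring_complex_field abelian_group_image])
    (auto simp: complex_field_def carrier_image smult_image add_image
      scale_left_distrib scale_right_distrib)

lemma finsum_image: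
  assumes "finite J"
  shows "(\<Oplus>\<^bsub>M\<^esub>j\<in>J. c j \<odot>\<^bsub>M\<^esub> \<phi> (a j)) = \<phi> (\<Sum>j\<in>J. sc (c j) (a j))"
  using assms
proof (induction J)
  interpret abelian_group M by (rule abelian_group_image)
  {
    case empty
    show ?case by (simp add: zero_image)
  next
    case (insert j J)
    then show ?case
      by (subst finsum_insert) (auto simp: smult_image carrier_image add_image)
  }
qed

lemma is_basis_image:
  assumes "finite J"
    and gen: "\<And>a. \<exists>c. \<phi> a = \<phi> (\<Sum>j\<in>J. sc (c j) (e j))"
    and ind: "\<And>c j. \<phi> (\<Sum>j\<in>J. sc (c j) (e j)) = \<phi> 0 \<Longrightarrow> j \<in> J \<Longrightarrow> c j = 0"
  shows "is_basis M J (\<lambda>j. \<phi> (e j))"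
  unfolding is_basis_def
proof (intro conjI ballI)
  show "(\<lambda>j. \<phi> (e j)) \<in> J \<rightarrow> carrier M" by (auto simp: carrier_image)
  fix v assume "v \<in> carrier M"
  then obtain a where a: "v = \<phi> a" by (auto simp: carrier_image)
  obtain c where c: "\<phi> a = \<phi> (\<Sum>j\<in>J. sc (c j) (e j))" using gen by blast
  show "\<exists>!c. c \<in> extensional J \<and> v = (\<Oplus>\<^bsub>M\<^esub>j\<in>J. c j \<odot>\<^bsub>M\<^esub> \<phi> (e j))"
  proof (rule ex1I[where a = "restrict c J"], intro conjI)
    have "(\<Sum>j\<in>J. sc (restrict c J j) (e j)) = (\<Sum>j\<in>J. sc (c j) (e j))"
      by (intro sum.cong) auto
    then show "v = (\<Oplus>\<^bsub>M\<^esub>j\<in>J. restrict c J j \<odot>\<^bsub>M\<^esub> \<phi> (e j))"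
      using a c by (simp only: finsum_image[OF assms(1)])
  next
    fix b assume b: "b \<in> extensional J \<and> v = (\<Oplus>\<^bsub>M\<^esub>j\<in>J. b j \<odot>\<^bsub>M\<^esub> \<phi> (e j))"
    then have eq: "\<phi> (\<Sum>j\<in>J. sc (b j) (e j)) = \<phi> (\<Sum>j\<in>J. sc (c j) (e j))"
      using a c by (simp add: finsum_image[OF assms(1)])
    \<comment> \<open>Uniqueness of coefficients reduces to the zero case \<open>ind\<close>,
      applied to the difference of the two coefficient families.\<close>
    have "\<phi> (\<Sum>j\<in>J. sc (b j - c j) (e j)) =
        \<phi> (\<Sum>j\<in>J. sc (b j) (e j)) \<oplus>\<^bsub>M\<^esub> \<phi> (- (\<Sum>j\<in>J. sc (c j) (e j)))"
      by (simp add: add_image scale_left_diff_distrib sum_subtractf)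
    also have "\<dots> = \<phi> 0"
      unfolding eq by (simp add: add_image)
    finally have "b j - c j = 0" if "j \<in> J" for j
      using ind[of "\<lambda>j. b j - c j"] that by simp
    then show "b = restrict c J"
      using b by (intro extensionalityI[of _ J]) auto
  qed simp
qed

end

text \<open>Complex scaling of a matrix is multiplication by a scalar matrix, because
  \<open>*s\<close> on the matrix type would take a row vector as its scalar.\<close>

definition mat_scale :: "complex \<Rightarrow> complex ^ 'n ^ 'n \<Rightarrow> complex ^ 'n ^ 'n" where
  "mat_scale c A = mat c ** A"

lemma mat_scale_vector_mult [simp]: "mat_scale c A *v v = c *s (A *v v)"
proof -
  have "mat c *v x = c *s x" for x :: "complex ^ 'a"
    by (simp add: vec_eq_iff matrix_vector_mult_def mat_def if_distrib[of "\<lambda>c. c * _"] cong: if_cong)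
  then show ?thesis
    by (simp add: mat_scale_def matrix_vector_mul_assoc[symmetric])
qed

lemma vector_space_mat_scale: "vector_space mat_scale"
  by unfold_locales
    (simp_all add: matrix_eq matrix_vector_mult_add_rdistrib vec.scale_left_distrib
      vec.scale_right_distrib)

lemma sum_matrix_vector_mult: "(\<Sum>j\<in>J. A j) *v v = (\<Sum>j\<in>J. A j *v v)"
  for A :: "'j \<Rightarrow> complex ^ 'n ^ 'm"
  by (induction J rule: infinite_finite_induct) (simp_all add: matrix_vector_mult_add_rdistrib)


section \<open>Homomorphisms into quotient spaces\<close>

lemma coset_eq_iff: "vec.subspace V \<Longrightarrow> coset V a = coset V b \<longleftrightarrow> a - b \<in> V"
proof
  assume V: "vec.subspace V" and "coset V a = coset V b"
  moreover have "a + 0 \<in> coset V a"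
    unfolding coset_def using vec.subspace_0[OF V] by (rule imageI)
  ultimately obtain w where "a + 0 = b + w" "w \<in> V" by (auto simp: coset_def)
  then show "a - b \<in> V" by simp
next
  assume V: "vec.subspace V" and ab: "a - b \<in> V"
  have "x \<in> coset V b" if "a - b \<in> V" "x \<in> coset V a" for a b x
  proof -
    from that(2) obtain w where "x = a + w" "w \<in> V" by (auto simp: coset_def)
    then have "x = b + ((a - b) + w)" "(a - b) + w \<in> V"
      using that(1) V by (auto intro: vec.subspace_add)
    then show ?thesis unfolding coset_def by (rule image_eqI)
  qed
  from this[of a b] this[of b a] ab vec.subspace_neg[OF V ab] show "coset V a = coset V b" by auto
qed

lemma coset_0 [simp]: "coset V 0 = V"
  by (simp add: coset_def)

lemma quotient_space_carrier: "carrier (quotient_space V) = range (coset V)"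
  and quotient_space_zero: "\<zero>\<^bsub>quotient_space V\<^esub> = coset V 0"
  by (simp_all add: quotient_space_def)

lemma quotient_space_add:
  assumes "vec.subspace V"
  shows "coset V a \<oplus>\<^bsub>quotient_space V\<^esub> coset V b = coset V (a + b)"
proof -
  have "{x + y |x y. x \<in> coset V a \<and> y \<in> coset V b} = coset V (a + b)"
  proof (intro equalityI subsetI)
    fix x assume "x \<in> {x + y |x y. x \<in> coset V a \<and> y \<in> coset V b}"
    then obtain u w where "x = (a + u) + (b + w)" "u \<in> V" "w \<in> V" by (auto simp: coset_def)
    then have "x = (a + b) + (u + w)" "u + w \<in> V"
      using assms by (auto intro: vec.subspace_add)
    then show "x \<in> coset V (a + b)" unfolding coset_def by (rule image_eqI)
  next
    fix x assume "x \<in> coset V (a + b)"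
    then obtain w where "x = (a + w) + (b + 0)" "w \<in> V" by (auto simp: coset_def)
    then show "x \<in> {x + y |x y. x \<in> coset V a \<and> y \<in> coset V b}"
      using vec.subspace_0[OF assms] unfolding coset_def by blast
  qed
  then show ?thesis by (simp add: quotient_space_def)
qed

text \<open>The summand from \<open>V\<close> in the definition of the scalar multiple matters for
  \<open>c = 0\<close>: the result is then \<open>V\<close>, the zero of the quotient, and not the
  set containing only 0.\<close>

lemma quotient_space_smult:
  assumes "vec.subspace V"
  shows "c \<odot>\<^bsub>quotient_space V\<^esub> coset V a = coset V (c *s a)"
proof -
  have "{c *s x + w |x w. x \<in> coset V a \<and> w \<in> V} = coset V (c *s a)"
  proof (intro equalityI subsetI)
    fix x assume "x \<in> {c *s x + w |x w. x \<in> coset V a \<and> w \<in> V}"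
    then obtain u w where "x = c *s (a + u) + w" "u \<in> V" "w \<in> V" by (auto simp: coset_def)
    then have "x = c *s a + (c *s u + w)" "c *s u + w \<in> V"
      using assms by (auto intro: vec.subspace_add vec.subspace_scale simp: vec.scale_right_distrib)
    then show "x \<in> coset V (c *s a)" unfolding coset_def by (rule image_eqI)
  next
    fix x assume "x \<in> coset V (c *s a)"
    then obtain w where "x = c *s (a + 0) + w" "w \<in> V" by (auto simp: coset_def)
    then show "x \<in> {c *s x + w |x w. x \<in> coset V a \<and> w \<in> V}"
      using vec.subspace_0[OF assms] unfolding coset_def by blast
  qed
  then show ?thesis by (simp add: quotient_space_def)
qed

section \<open>Maps into a quotient induced by matrices\<close>

definition induced_map ::
    "(complex ^ 'n) set \<Rightarrow> (complex ^ 'n) set \<Rightarrow> complex ^ 'n ^ 'n \<Rightarrow> complex ^ 'n \<Rightarrow> (complex ^ 'n) set" where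
  "induced_map H V A = (\<lambda>v\<in>H. coset V (A *v v))"

lemma hom_space_carrier:
  "f \<in> carrier (hom_space H (quotient_space V)) \<longleftrightarrow>
     f \<in> extensional H \<and> (\<forall>u\<in>H. f u \<in> range (coset V)) \<and>
     (\<forall>u\<in>H. \<forall>v\<in>H. f (u + v) = f u \<oplus>\<^bsub>quotient_space V\<^esub> f v) \<and>
     (\<forall>c. \<forall>u\<in>H. f (c *s u) = c \<odot>\<^bsub>quotient_space V\<^esub> f u)"
  by (auto simp: hom_space_def quotient_space_carrier PiE_iff)

lemma induced_map_in_hom_space:
  assumes "vec.subspace H" "vec.subspace V"
  shows "induced_map H V A \<in> carrier (hom_space H (quotient_space V))"
  using assms
  by (auto simp: hom_space_carrier induced_map_def quotient_space_add quotient_space_smult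
      matrix_vector_right_distrib vec.subspace_add vec.subspace_scale vec.linear_scale)

text \<open>The vectors on which two homomorphisms agree form a subspace. If it contains
  \<open>B\<close> it is the whole span, and off the span both maps are
  \<open>undefined\<close>.\<close>

lemma hom_space_eqI:
  assumes V: "vec.subspace V"
    and f: "f \<in> carrier (hom_space (vec.span B) (quotient_space V))"
    and g: "g \<in> carrier (hom_space (vec.span B) (quotient_space V))"
    and eq: "\<And>v. v \<in> B \<Longrightarrow> f v = g v"
  shows "f = g"
proof -
  let ?H = "vec.span B"
  \<comment> \<open>The value at 0 follows from homogeneity with the scalar 0.\<close>
  have 0: "f 0 = coset V 0" if f: "f \<in> carrier (hom_space ?H (quotient_space V))" for f
  proof -
    obtain a where "f 0 = coset V a"
      using f vec.span_zero[of B] by (force simp: hom_space_carrier)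
    moreover have "f (0 *s 0) = 0 \<odot>\<^bsub>quotient_space V\<^esub> f 0"
      using f vec.span_zero[of B] unfolding hom_space_carrier by blast
    ultimately show ?thesis by (simp add: quotient_space_smult[OF V])
  qed
  have "?H \<subseteq> {v \<in> ?H. f v = g v}"
  proof (rule vec.span_minimal)
    show "B \<subseteq> {v \<in> ?H. f v = g v}" using eq by (auto intro: vec.span_base)
    show "vec.subspace {v \<in> ?H. f v = g v}"
      using 0[OF f] 0[OF g] f g
      by (intro vec.subspaceI)
        (auto simp: hom_space_carrier vec.span_zero vec.span_add vec.span_scale)
  qed
  then show ?thesis
    using f g by (intro extensionalityI[of _ ?H]) (auto simp: hom_space_carrier)
qed

text \<open>The values on a basis of \<open>H\<close> are lifted from the quotient to vectors, and a
  linear map of the whole space with these values on the basis is taken.\<close>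

lemma hom_space_lift:
  fixes H :: "(complex ^ 'n::finite) set"
  assumes H: "vec.subspace H" and V: "vec.subspace V"
    and f: "f \<in> carrier (hom_space H (quotient_space V))"
  obtains A where "f = induced_map H V A"
proof -
  obtain B where B: "B \<subseteq> H" "vec.independent B" "H \<subseteq> vec.span B"
    using vec.basis_exists by metis
  have span: "vec.span B = H" using B H by (intro equalityI vec.span_minimal)
  have "\<forall>v\<in>B. \<exists>a. f v = coset V a" using f B(1) unfolding hom_space_carrier by blast
  then obtain t where t: "\<forall>v\<in>B. f v = coset V (t v)" by metis
  obtain g where g: "Vector_Spaces.linear (*s) (*s) g" "\<forall>x\<in>B. g x = t x"
    using vec.linear_independent_extend[OF B(2), of t] by blast
  have "f = induced_map H V (matrix g)"
    using hom_space_eqI[OF V, of f B "induced_map H V (matrix g)"] f B(1) g t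
      induced_map_in_hom_space[OF H V, of "matrix g"]
    by (auto simp: span induced_map_def matrix_works subset_iff)
  then show thesis by (rule that)
qed

lemma hom_space_image:
  fixes H :: "(complex ^ 'n::finite) set"
  assumes H: "vec.subspace H" and V: "vec.subspace V"
  shows "module_image mat_scale (induced_map H V) (hom_space H (quotient_space V))"
proof -
  interpret vector_space "mat_scale :: complex \<Rightarrow> complex ^ 'n ^ 'n \<Rightarrow> _"
    by (rule vector_space_mat_scale)
  show ?thesis
  proof
    show "carrier (hom_space H (quotient_space V)) = range (induced_map H V)"
      using induced_map_in_hom_space[OF H V] hom_space_lift[OF H V] by (metis (no_types, lifting) image_subsetI rangeI subsetI subset_antisym)
    show "\<zero>\<^bsub>hom_space H (quotient_space V)\<^esub> = induced_map H V 0"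
      by (simp add: hom_space_def induced_map_def quotient_space_zero)
    fix a b c
    show "induced_map H V a \<oplus>\<^bsub>hom_space H (quotient_space V)\<^esub> induced_map H V b = induced_map H V (a + b)"
      by (auto simp: hom_space_def induced_map_def quotient_space_add[OF V]
          matrix_vector_mult_add_rdistrib intro!: restrict_ext)
    show "c \<odot>\<^bsub>hom_space H (quotient_space V)\<^esub> induced_map H V a = induced_map H V (mat_scale c a)"
      by (auto simp: hom_space_def induced_map_def quotient_space_smult[OF V] intro!: restrict_ext)
  qed
qed

text \<open>All cosets in the union that defines \<open>quotient_map\<close> coincide, since
  \<open>V\<close> lies in \<open>V'\<close>; \<open>0 \<in> V\<close> makes the union
  nonempty.\<close>

lemma quotient_map_coset:
  assumes "vec.subspace V'" "V \<subseteq> V'" "0 \<in> V"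
  shows "quotient_map V' (coset V a) = coset V' a"
proof -
  have "coset V' (a + w) = coset V' a" if "w \<in> V" for w
    using coset_eq_iff[OF assms(1)] that assms(2) by auto
  then show ?thesis using assms(3) by (auto simp: quotient_map_def coset_def[of V])
qed


section \<open>Flags and the fibres of E\<close>

lemma flagsD:
  assumes "V \<in> flags k d"
  shows "i \<in> {1..k} \<Longrightarrow> vec.subspace (V i)" "i \<in> {1..k} \<Longrightarrow> vec.dim (V i) = d i"
    "i \<in> {1..<k} \<Longrightarrow> V i \<subseteq> V (i + 1)" "V k = UNIV" "V \<in> extensional {1..k}"
  using assms by (auto simp: flags_def)

text \<open>Inclusions suffice because corresponding steps have the same dimension. This is how
  vanishing of \<open>eta\<close> forces a point onto the diagonal.\<close>

lemma flags_eqI: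
  assumes "V \<in> flags k d" "V' \<in> flags k d" "\<And>i. i \<in> {1..<k} \<Longrightarrow> V i \<subseteq> V' i"
  shows "V = V'"
proof (rule extensionalityI[of _ "{1..k}"])
  fix i assume i: "i \<in> {1..k}"
  show "V i = V' i"
  proof (cases "i = k")
    case False
    then have "vec.dim (V' i) \<le> vec.dim (V i)" "V i \<subseteq> V' i"
      using i assms by (auto simp: flagsD(2)[OF assms(1)] flagsD(2)[OF assms(2)])
    then show ?thesis using i flagsD(1)[OF assms(1)] flagsD(1)[OF assms(2)]
      by (intro vec.subspace_dim_equal) auto
  qed (use assms flagsD(4) in metis)
qed (use assms flagsD(5) in auto)

text \<open>A basis of each step is extended to one of the next. The induction also carries
  \<open>d i \<le> d m\<close>, so that an extension leaves the bases of the earlier steps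
  unchanged.\<close>

lemma adapted_basis_exists:
  fixes V :: "'n::finite flag"
  assumes V: "V \<in> flags k d" and "1 \<le> k"
  obtains w where "independent_family {1..d k} w" "\<And>i. i \<in> {1..k} \<Longrightarrow> V i = vec.span (w ` {1..d i})"
proof -
  have "\<exists>w. independent_family {1..d m} w \<and> (\<forall>i\<in>{1..m}. V i = vec.span (w ` {1..d i})) \<and>
      (\<forall>i\<in>{1..m}. d i \<le> d m)"
    if "1 \<le> m" "m \<le> k" for m
    using that
  proof (induction m rule: dec_induct)
    case base
    \<comment> \<open>The first step is treated as an extension of the empty family.\<close>
    have 1: "independent_family {1..0::nat} (\<lambda>_. 0 :: complex ^ 'n)" by (simp add: independent_family_def)
    have 2: "vec.span ((\<lambda>_. 0 :: complex ^ 'n) ` {1..0::nat}) \<subseteq> V 1"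
      using vec.subspace_0[OF flagsD(1)[OF V, of 1]] assms(2) by simp
    have "vec.subspace (V 1)" "vec.dim (V 1) = d 1"
      using flagsD(1,2)[OF V, of 1] assms(2) by simp_all
    from extend_independent_family[OF 1 2 this] obtain u
      where "independent_family {1..d 1} u" "vec.span (u ` {1..d 1}) = V 1" by metis
    then show ?case by auto
  next
    case (step m)
    then obtain w where w: "independent_family {1..d m} w"
      "\<forall>i\<in>{1..m}. V i = vec.span (w ` {1..d i})" "\<forall>i\<in>{1..m}. d i \<le> d m" by auto
    have sub: "vec.span (w ` {1..d m}) \<subseteq> V (Suc m)"
      using w(2) flagsD(3)[OF V, of m] step.hyps step.prems by auto
    have "vec.subspace (V (Suc m))" "vec.dim (V (Suc m)) = d (Suc m)"
      using flagsD(1,2)[OF V, of "Suc m"] step.prems by simp_all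
    from extend_independent_family[OF w(1) sub this]
    obtain u where u: "\<forall>j\<in>{1..d m}. u j = w j" "independent_family {1..d (Suc m)} u"
      "vec.span (u ` {1..d (Suc m)}) = V (Suc m)" "d m \<le> d (Suc m)"
      by metis
    have "V i = vec.span (u ` {1..d i})" if i: "i \<in> {1..m}" for i
    proof -
      have "d i \<le> d m" using w(3) i by blast
      then have "u ` {1..d i} = w ` {1..d i}" using u(1) by (intro image_cong) auto
      then show ?thesis using w(2) i by simp
    qed
    moreover have "d i \<le> d (Suc m)" if "i \<in> {1..m}" for i
      using bspec[OF w(3) that] u(4) by linarith
    ultimately show ?case using u(2,3) by (intro exI[of _ u]) (auto simp: le_Suc_eq)
  qed
  from this[OF assms(2) order_refl] show thesis using that by blast
qed

text \<open>The class of a matrix in the fibre of E. Source steps come from the second flag and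
  quotients from the first, as in Hom of \<open>H\<close> at \<open>\<zeta>\<close> into
  \<open>F\<close> at \<open>z\<close>.\<close>

definition E_map ::
    "nat \<Rightarrow> 'n flag \<times> 'n flag \<Rightarrow> complex ^ 'n ^ 'n \<Rightarrow> nat \<Rightarrow> complex ^ 'n \<Rightarrow> (complex ^ 'n) set" where
  "E_map k p A = (\<lambda>i\<in>{1..<k}. induced_map (snd p i) (fst p i) A)"

lemma eta_eq_E_map: "eta k p = E_map k p (mat 1)"
  by (cases p) (simp add: eta_def E_map_def induced_map_def)

lemma restrict_eq_iff: "restrict g J = restrict h J \<longleftrightarrow> (\<forall>i\<in>J. g i = h i)"
  by (auto simp: fun_eq_iff restrict_def)

text \<open>Both terms of each component of \<open>Phi\<close> are induced by matrices, hence lie in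
  one abelian group, where a zero difference means equality. The kernel condition thus becomes
  compatibility of consecutive components.\<close>

lemma E_fibre_carrier_iff:
  fixes z \<zeta> :: "'n::finite flag"
  assumes z: "z \<in> flags k d" and \<zeta>: "\<zeta> \<in> flags k d"
  shows "f \<in> carrier (E_fibre k (z, \<zeta>)) \<longleftrightarrow> f \<in> extensional {1..<k} \<and>
    (\<forall>i\<in>{1..<k}. f i \<in> carrier (hom_space (\<zeta> i) (quotient_space (z i)))) \<and>
    (\<forall>i\<in>{1..<k - 1}. \<forall>v\<in>\<zeta> i. f (i + 1) v = quotient_map (z (i + 1)) (f i v))"
proof -
  define H where "H = (\<lambda>i. hom_space (\<zeta> i) (quotient_space (z (i + 1))))"
  have diff: "restrict (f (i + 1)) (\<zeta> i) \<ominus>\<^bsub>H i\<^esub> compose (\<zeta> i) (quotient_map (z (i + 1))) (f i) = \<zero>\<^bsub>H i\<^esub>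
      \<longleftrightarrow> (\<forall>v\<in>\<zeta> i. f (i + 1) v = quotient_map (z (i + 1)) (f i v))"
    if hom: "\<forall>i\<in>{1..<k}. f i \<in> carrier (hom_space (\<zeta> i) (quotient_space (z i)))"
      and i: "i \<in> {1..<k - 1}" for i
  proof -
    have i': "i \<in> {1..k}" "i + 1 \<in> {1..k}" "i \<in> {1..<k}" "i + 1 \<in> {1..<k}" using i by auto
    note sub = flagsD(1)[OF z i'(1)] flagsD(1)[OF z i'(2)] flagsD(1)[OF \<zeta> i'(1)] flagsD(1)[OF \<zeta> i'(2)]
    obtain A where A: "f i = induced_map (\<zeta> i) (z i) A"
      using hom_space_lift sub hom i' by metis
    obtain B where B: "f (i + 1) = induced_map (\<zeta> (i + 1)) (z (i + 1)) B"
      using hom_space_lift sub hom i' by metis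
    have "restrict (f (i + 1)) (\<zeta> i) = induced_map (\<zeta> i) (z (i + 1)) B"
      using flagsD(3)[OF \<zeta> i'(3)] unfolding B induced_map_def by (auto simp: restrict_def fun_eq_iff)
    moreover have "compose (\<zeta> i) (quotient_map (z (i + 1))) (f i) = induced_map (\<zeta> i) (z (i + 1)) A"
      using flagsD(3)[OF z i'(3)] vec.subspace_0[OF sub(1)]
      unfolding A induced_map_def compose_def
      by (intro restrict_ext) (simp add: quotient_map_coset[OF sub(2)] del: One_nat_def add_Suc_right)
    moreover have "x \<ominus>\<^bsub>H i\<^esub> y = \<zero>\<^bsub>H i\<^esub> \<longleftrightarrow> x = y" if "x \<in> carrier (H i)" "y \<in> carrier (H i)" for x y
    proof -
      interpret abelian_group "H i"
        unfolding H_def using hom_space_image[OF sub(3,2)] by (rule module_image.abelian_group_image)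
      show ?thesis
        using that by (metis a_inv_closed add.inv_closed add.m_assoc l_neg l_zero minus_eq r_neg r_zero)
    qed
    ultimately have "restrict (f (i + 1)) (\<zeta> i) \<ominus>\<^bsub>H i\<^esub> compose (\<zeta> i) (quotient_map (z (i + 1))) (f i) = \<zero>\<^bsub>H i\<^esub>
        \<longleftrightarrow> restrict (f (i + 1)) (\<zeta> i) = compose (\<zeta> i) (quotient_map (z (i + 1))) (f i)"
      using induced_map_in_hom_space[OF sub(3,2)]
      by (simp add: H_def)
    also have "\<dots> \<longleftrightarrow> (\<forall>v\<in>\<zeta> i. f (i + 1) v = quotient_map (z (i + 1)) (f i v))"
      by (simp add: compose_def restrict_eq_iff)
    finally show ?thesis .
  qed
  have "f \<in> carrier (E_fibre k (z, \<zeta>)) \<longleftrightarrow> f \<in> extensional {1..<k} \<and>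
    (\<forall>i\<in>{1..<k}. f i \<in> carrier (hom_space (\<zeta> i) (quotient_space (z i)))) \<and>
    (\<forall>i\<in>{1..<k - 1}. restrict (f (i + 1)) (\<zeta> i) \<ominus>\<^bsub>H i\<^esub>
       compose (\<zeta> i) (quotient_map (z (i + 1))) (f i) = \<zero>\<^bsub>H i\<^esub>)"
    by (simp add: E_fibre_def hom_sum_def hom_sum_shifted_def direct_sum_def Phi_def H_def
        PiE_iff restrict_eq_iff conj_ac)
  then show ?thesis using diff by blast
qed

text \<open>Compatibility carries the value at an adapted basis vector from the first step
  containing it to all later steps. One lift per basis vector therefore serves every component, and
  the lifts define a single matrix.\<close>

lemma E_fibre_carrier:
  fixes z \<zeta> :: "'n::finite flag"
  assumes z: "z \<in> flags k d" and \<zeta>: "\<zeta> \<in> flags k d" and k: "1 \<le> k"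
  shows "carrier (E_fibre k (z, \<zeta>)) = range (E_map k (z, \<zeta>))"
proof (intro equalityI subsetI)
  fix f assume "f \<in> range (E_map k (z, \<zeta>))"
  then obtain A where f: "f = E_map k (z, \<zeta>) A" by blast
  have "f (i + 1) v = quotient_map (z (i + 1)) (f i v)" if "i \<in> {1..<k - 1}" "v \<in> \<zeta> i" for i v
    using that flagsD(3)[OF z, of i] flagsD(3)[OF \<zeta>, of i]
      vec.subspace_0[OF flagsD(1)[OF z, of i]] flagsD(1)[OF z, of "i + 1"]
    by (auto simp: f E_map_def induced_map_def quotient_map_coset subset_iff)
  then show "f \<in> carrier (E_fibre k (z, \<zeta>))"
    using flagsD(1)[OF z] flagsD(1)[OF \<zeta>]
    by (auto simp: E_fibre_carrier_iff[OF z \<zeta>] f E_map_def intro!: induced_map_in_hom_space)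
next
  fix f assume f: "f \<in> carrier (E_fibre k (z, \<zeta>))"
  note f = f[unfolded E_fibre_carrier_iff[OF z \<zeta>]]
  obtain w where w: "independent_family {1..d k} w" "\<And>i. i \<in> {1..k} \<Longrightarrow> \<zeta> i = vec.span (w ` {1..d i})"
    using adapted_basis_exists[OF \<zeta> k] by blast
  \<comment> \<open>\<open>l j\<close> is the first step containing \<open>w j\<close>, and
    \<open>t j\<close> represents the value there. If \<open>l j = k\<close>, no component of
    \<open>f\<close> constrains \<open>t j\<close>.\<close>
  define l where "l = (\<lambda>j. LEAST i. 1 \<le> i \<and> j \<le> d i)"
  define t where "t = (\<lambda>j. SOME a. f (l j) (w j) = coset (z (l j)) a)"
  obtain A :: "complex ^ 'n ^ 'n" where A: "\<And>j. j \<in> {1..d k} \<Longrightarrow> A *v w j = t j"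
    using matrix_on_family[OF w(1)] by blast
  have w_in: "w j \<in> \<zeta> i" if "i \<in> {1..k}" "j \<in> {1..d i}" for i j
    using w(2) that by (auto intro: vec.span_base)
  have lift: "f i (w j) = coset (z i) (t j)" if "i \<in> {1..<k}" "j \<in> {1..d i}" for i j
  proof -
    have l: "1 \<le> l j" "j \<le> d (l j)" "l j \<le> i"
      using LeastI[of "\<lambda>i. 1 \<le> i \<and> j \<le> d i" i] Least_le[of "\<lambda>i. 1 \<le> i \<and> j \<le> d i" i] that
      by (auto simp: l_def)
    have "i < k \<longrightarrow> w j \<in> \<zeta> i \<and> f i (w j) = coset (z i) (t j)"
      using l(3)
    proof (induction i rule: dec_induct)
      case base
      have wj: "w j \<in> \<zeta> (l j)" if "l j < k" using w_in[of "l j" j] l that \<open>j \<in> {1..d i}\<close> by simp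
      have "f (l j) (w j) = coset (z (l j)) (t j)" if "l j < k"
      proof -
        have "l j \<in> {1..<k}" using l that by simp
        then have "f (l j) \<in> carrier (hom_space (\<zeta> (l j)) (quotient_space (z (l j))))" using f by blast
        then have "\<exists>a. f (l j) (w j) = coset (z (l j)) a"
          using wj[OF that] unfolding hom_space_carrier by blast
        then show ?thesis unfolding t_def by (rule someI_ex)
      qed
      then show ?case using wj by simp
    next
      case (step m)
      then have m: "m + 1 < k \<Longrightarrow> m \<in> {1..<k - 1}" using l by auto
      show ?case
      proof (intro impI conjI)
        assume *: "Suc m < k"
        have IH: "w j \<in> \<zeta> m" "f m (w j) = coset (z m) (t j)" using step * by auto
        show "w j \<in> \<zeta> (Suc m)" using flagsD(3)[OF \<zeta>, of m] m * IH by auto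
        have "f (m + 1) (w j) = quotient_map (z (m + 1)) (f m (w j))"
          using f m * IH by auto
        then show "f (Suc m) (w j) = coset (z (Suc m)) (t j)"
          using IH flagsD(3)[OF z, of m] m * flagsD(1)[OF z, of "m + 1"]
            vec.subspace_0[OF flagsD(1)[OF z, of m]]
          by (simp add: quotient_map_coset)
      qed
    qed
    then show ?thesis using that by simp
  qed
  have "f i = induced_map (\<zeta> i) (z i) A" if i: "i \<in> {1..<k}" for i
  proof -
    have i': "i \<in> {1..k}" using i by auto
    note sub = flagsD(1)[OF z i'] flagsD(1)[OF \<zeta> i']
    have "d i \<le> d k"
      using flagsD(2)[OF \<zeta> i'] flagsD(2)[OF \<zeta>, of k] k vec.dim_subset[of "\<zeta> i" "\<zeta> k"] flagsD(4)[OF \<zeta>]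
      by auto
    then have eq: "f i (w j) = induced_map (\<zeta> i) (z i) A (w j)" if "j \<in> {1..d i}" for j
      using lift[OF i that] A[of j] w_in[OF i' that] that by (simp add: induced_map_def)
    show ?thesis
    proof (rule hom_space_eqI[OF sub(1), of _ "w ` {1..d i}", folded w(2)[OF i']])
      show "f i \<in> carrier (hom_space (\<zeta> i) (quotient_space (z i)))" using f i by blast
      show "induced_map (\<zeta> i) (z i) A \<in> carrier (hom_space (\<zeta> i) (quotient_space (z i)))"
        by (rule induced_map_in_hom_space[OF sub(2,1)])
      show "f i v = induced_map (\<zeta> i) (z i) A v" if "v \<in> w ` {1..d i}" for v
        using that eq by blast
    qed
  qed
  then have "f = E_map k (z, \<zeta>) A"
    using f by (intro extensionalityI[of _ "{1..<k}"]) (auto simp: E_map_def)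
  then show "f \<in> range (E_map k (z, \<zeta>))" by blast
qed

lemma E_fibre_image:
  fixes p :: "'n::finite flag \<times> 'n flag"
  assumes p: "p \<in> flags k d \<times> flags k d" and k: "1 \<le> k"
  shows "module_image mat_scale (E_map k p) (E_fibre k p)"
proof -
  interpret vector_space "mat_scale :: complex \<Rightarrow> complex ^ 'n ^ 'n \<Rightarrow> _"
    by (rule vector_space_mat_scale)
  obtain z \<zeta> where p_eq: "p = (z, \<zeta>)" and z: "z \<in> flags k d" and \<zeta>: "\<zeta> \<in> flags k d"
    using p by auto
  have hom: "module_image mat_scale (induced_map (\<zeta> i) (z i)) (hom_space (\<zeta> i) (quotient_space (z i)))"
    if "i \<in> {1..<k}" for i
    using flagsD(1)[OF z] flagsD(1)[OF \<zeta>] that by (intro hom_space_image) auto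
  show ?thesis
    unfolding p_eq
  proof
    show "carrier (E_fibre k (z, \<zeta>)) = range (E_map k (z, \<zeta>))"
      by (rule E_fibre_carrier[OF z \<zeta> k])
    show "\<zero>\<^bsub>E_fibre k (z, \<zeta>)\<^esub> = E_map k (z, \<zeta>) 0"
      using module_image.zero_image[OF hom]
      by (auto simp: E_fibre_def hom_sum_def direct_sum_def E_map_def intro!: restrict_ext)
    fix a b c
    show "E_map k (z, \<zeta>) a \<oplus>\<^bsub>E_fibre k (z, \<zeta>)\<^esub> E_map k (z, \<zeta>) b = E_map k (z, \<zeta>) (a + b)"
      using module_image.add_image[OF hom]
      by (auto simp: E_fibre_def hom_sum_def direct_sum_def E_map_def intro!: restrict_ext)
    show "c \<odot>\<^bsub>E_fibre k (z, \<zeta>)\<^esub> E_map k (z, \<zeta>) a = E_map k (z, \<zeta>) (mat_scale c a)"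
      using module_image.smult_image[OF hom]
      by (auto simp: E_fibre_def hom_sum_def direct_sum_def E_map_def intro!: restrict_ext)
  qed
qed

section \<open>Equality of classes and the zero set of the section\<close>

lemma E_map_eq_iff:
  assumes "z \<in> flags k d" "\<zeta> \<in> flags k d"
  shows "E_map k (z, \<zeta>) A = E_map k (z, \<zeta>) B \<longleftrightarrow> (\<forall>i\<in>{1..<k}. \<forall>v\<in>\<zeta> i. A *v v - B *v v \<in> z i)"
proof -
  have "E_map k (z, \<zeta>) A = E_map k (z, \<zeta>) B \<longleftrightarrow>
      (\<forall>i\<in>{1..<k}. \<forall>v\<in>\<zeta> i. coset (z i) (A *v v) = coset (z i) (B *v v))"
    by (simp add: E_map_def induced_map_def restrict_eq_iff)
  also have "\<dots> \<longleftrightarrow> (\<forall>i\<in>{1..<k}. \<forall>v\<in>\<zeta> i. A *v v - B *v v \<in> z i)"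
    using flagsD(1)[OF assms(1)] by (auto simp: coset_eq_iff)
  finally show ?thesis .
qed

text \<open>If the class of the identity matrix is zero, each step of \<open>\<zeta>\<close> lies in
  the corresponding step of \<open>z\<close>, and equal dimensions give
  \<open>z = \<zeta>\<close>.\<close>

lemma eta_nonzero:
  fixes p :: "'n::finite flag \<times> 'n flag"
  assumes p: "p \<in> flags k d \<times> flags k d - Id_on (flags k d)" and k: "1 \<le> k"
  shows "eta k p \<noteq> \<zero>\<^bsub>E_fibre k p\<^esub>"
proof
  obtain z \<zeta> where p_eq: "p = (z, \<zeta>)" and z: "z \<in> flags k d" and \<zeta>: "\<zeta> \<in> flags k d" and "z \<noteq> \<zeta>"
    using p by auto
  assume "eta k p = \<zero>\<^bsub>E_fibre k p\<^esub>"
  then have "E_map k (z, \<zeta>) (mat 1) = E_map k (z, \<zeta>) 0"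
    using module_image.zero_image[OF E_fibre_image, of p k d] z \<zeta> k by (simp add: p_eq eta_eq_E_map)
  then have "\<zeta> i \<subseteq> z i" if "i \<in> {1..<k}" for i
    using that by (auto simp: E_map_eq_iff[OF z \<zeta>])
  then show False using flags_eqI[OF \<zeta> z] \<open>z \<noteq> \<zeta>\<close> by blast
qed

lemma eta_diagonal:
  fixes z :: "'n::finite flag"
  assumes z: "z \<in> flags k d" and k: "1 \<le> k"
  shows "eta k (z, z) = \<zero>\<^bsub>E_fibre k (z, z)\<^esub>"
  using module_image.zero_image[OF E_fibre_image, of "(z, z)" k d] z k
  by (simp add: eta_eq_E_map E_map_eq_iff)


section \<open>The charts of the flag manifold\<close>

text \<open>Comparing coefficients of the \<open>b s\<close> turns a relation into a unitriangular
  system for \<open>c\<close>, which is solved from the smallest index upwards.\<close>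

lemma unitriangular_independent_family:
  fixes b :: "nat \<Rightarrow> complex ^ 'n::finite"
  assumes b: "independent_family {1..N} b" and X: "\<And>s j. X s j \<noteq> 0 \<Longrightarrow> j < s"
  shows "independent_family {1..N} (\<lambda>j. b j + (\<Sum>s\<in>{1..N}. X s j *s b s))"
  unfolding independent_family_def
proof (intro allI impI)
  fix c assume *: "(\<Sum>j\<in>{1..N}. c j *s (b j + (\<Sum>s\<in>{1..N}. X s j *s b s))) = 0"
  have "(\<Sum>j\<in>{1..N}. c j *s (b j + (\<Sum>s\<in>{1..N}. X s j *s b s))) =
      (\<Sum>j\<in>{1..N}. c j *s b j) + (\<Sum>j\<in>{1..N}. \<Sum>s\<in>{1..N}. (c j * X s j) *s b s)"
    by (simp add: vec.scale_right_distrib sum.distrib vec.scale_sum_right)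
  also have "(\<Sum>j\<in>{1..N}. \<Sum>s\<in>{1..N}. (c j * X s j) *s b s) =
      (\<Sum>s\<in>{1..N}. (\<Sum>j\<in>{1..N}. c j * X s j) *s b s)"
    by (subst sum.swap) (simp add: vec.scale_sum_left)
  also have "(\<Sum>j\<in>{1..N}. c j *s b j) + \<dots> =
      (\<Sum>s\<in>{1..N}. (c s + (\<Sum>j\<in>{1..N}. c j * X s j)) *s b s)"
    by (simp add: vec.scale_left_distrib sum.distrib)
  finally have coeff: "c s + (\<Sum>j\<in>{1..N}. c j * X s j) = 0" if "s \<in> {1..N}" for s
    using independent_familyD[OF b, of "\<lambda>s. c s + (\<Sum>j\<in>{1..N}. c j * X s j)"] * that by simp
  have "s \<in> {1..N} \<longrightarrow> c s = 0" for s
  proof (induction s rule: less_induct)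
    case (less s)
    show ?case
    proof
      assume s: "s \<in> {1..N}"
      have "c j * X s j = 0" if "j \<in> {1..N}" for j
        using less.IH[of j] X[of s j] that by (cases "X s j = 0") auto
      then have "(\<Sum>j\<in>{1..N}. c j * X s j) = 0" by (rule sum.neutral[OF ballI])
      with coeff[OF s] show "c s = 0" by simp
    qed
  qed
  then show "\<forall>j\<in>{1..N}. c j = 0" by blast
qed

section \<open>Block structure of the index set\<close>

locale flag_type =
  fixes k :: nat and d :: "nat \<Rightarrow> nat"
  assumes k_pos: "1 \<le> k" and d_less: "\<forall>i\<in>{1..<k}. d i < d (i + 1)"
begin

lemma d_mono:
  assumes "1 \<le> i" "i \<le> j" "j \<le> k"
  shows "d i \<le> d j"
  using assms(2,3)
proof (induction j rule: dec_induct)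
  case (step j)
  then have "d j < d (Suc j)" using d_less assms(1) by auto
  then show ?case using step by simp
qed simp

text \<open>The number of the block containing column \<open>j\<close>: the first step of the flag
  to which the \<open>j\<close>-th vector of an adapted basis belongs.\<close>

definition level :: "nat \<Rightarrow> nat" where
  "level j = (LEAST i. 1 \<le> i \<and> j \<le> d i)"

lemma level:
  assumes "j \<in> {1..d k}"
  shows "level j \<in> {1..k}" "j \<le> d (level j)"
  using LeastI[of "\<lambda>i. 1 \<le> i \<and> j \<le> d i" k] Least_le[of "\<lambda>i. 1 \<le> i \<and> j \<le> d i" k] assms k_pos
  by (auto simp: level_def)

lemma le_d_iff_level_le:
  assumes "j \<in> {1..d k}" "i \<in> {1..k}"
  shows "j \<le> d i \<longleftrightarrow> level j \<le> i"
proof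
  assume "j \<le> d i"
  then show "level j \<le> i"
    unfolding level_def using assms(2) by (intro Least_le) simp
next
  assume "level j \<le> i"
  then show "j \<le> d i"
    using level[OF assms(1)] d_mono[of "level j" i] assms(2) by auto
qed

text \<open>Read column by column, the union of blocks leaves in column \<open>j\<close> exactly the
  rows below its diagonal block.\<close>

lemma flag_coords_iff: "(r, j) \<in> flag_coords k d \<longleftrightarrow> j \<in> {1..d k} \<and> r \<in> {d (level j) <.. d k}"
proof
  assume "(r, j) \<in> flag_coords k d"
  then obtain i where i: "i \<in> {1..<k}" "d i < r" "r \<le> d (i + 1)" "1 \<le> j" "j \<le> d i"
    by (auto simp: flag_coords_def)
  have j: "j \<in> {1..d k}" using i d_mono[of i k] by auto
  then have "level j \<le> i" using le_d_iff_level_le[of j i] i by auto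
  then have "d (level j) \<le> d i" using d_mono level(1)[OF j] i by auto
  then show "j \<in> {1..d k} \<and> r \<in> {d (level j) <.. d k}"
    using i j d_mono[of "i + 1" k] by auto
next
  assume *: "j \<in> {1..d k} \<and> r \<in> {d (level j) <.. d k}"
  then have r: "r \<in> {1..d k}" by auto
  have lt: "level j < level r" using le_d_iff_level_le[OF r, of "level j"] level * by fastforce
  \<comment> \<open>The pair belongs to the member of the union whose rows are those of the block of
    \<open>r\<close>, that is, \<open>d i < r\<close> and \<open>r \<le> d (i + 1)\<close>.\<close>
  define i where "i = level r - 1"
  have i: "level r = i + 1" "level j \<le> i" "i \<in> {1..<k}" "i \<in> {1..k}"
    using lt level(1)[OF r] level(1)[of j] * by (auto simp: i_def)
  have "\<not> r \<le> d i" using le_d_iff_level_le[OF r i(4)] i(1) by simp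
  moreover have "j \<le> d i" using le_d_iff_level_le[of j i] i * by simp
  moreover have "r \<le> d (i + 1)" using level(2)[OF r] i(1) by simp
  ultimately show "(r, j) \<in> flag_coords k d"
    using i(3) * unfolding flag_coords_def by (intro UN_I[of i]) auto
qed

lemma finite_flag_coords: "finite (flag_coords k d)"
  by (simp add: flag_coords_def)

lemma flag_coords_rows: "j \<in> {1..d k} \<Longrightarrow> {r. (r, j) \<in> flag_coords k d} = {d (level j) <.. d k}"
  by (auto simp: flag_coords_iff)

lemma adapted_vector_eq:
  "j \<in> {1..d k} \<Longrightarrow> adapted_vector k d b x j = b j + (\<Sum>r\<in>{d (level j) <.. d k}. x (r, j) *s b r)"
  by (simp add: adapted_vector_def flag_coords_rows)

text \<open>In the chart given by \<open>b\<close>, the vectors \<open>b r\<close> with \<open>d i < r\<close> span a complement of the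
  \<open>i\<close>-th step of every flag. Being independent of the flag, they yield a frame of the quotient
  bundle in which the coefficients of \<open>\<eta>\<close> are differences of coordinates.\<close>

lemma independent_adapted_complement:
  fixes b :: "nat \<Rightarrow> complex ^ 'n::finite"
  assumes b: "independent_family {1..d k} b"
  shows "independent_family {1..d k} (\<lambda>j. if j \<le> d i then adapted_vector k d b x j else b j)"
proof -
  \<comment> \<open>These are the strictly lower triangular entries, set to zero in the columns
    beyond \<open>d i\<close>, where the family keeps \<open>b j\<close> itself.\<close>
  define X where "X = (\<lambda>s j. if j \<le> d i \<and> (s, j) \<in> flag_coords k d then x (s, j) else 0)"
  have "(if j \<le> d i then adapted_vector k d b x j else b j) = b j + (\<Sum>s\<in>{1..d k}. X s j *s b s)"
    if j: "j \<in> {1..d k}" for j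
  proof (cases "j \<le> d i")
    case True
    have "(\<Sum>r\<in>{d (level j) <.. d k}. x (r, j) *s b r) = (\<Sum>s\<in>{1..d k}. X s j *s b s)"
      using j True by (intro sum.mono_neutral_cong_left) (auto simp: X_def flag_coords_iff)
    then show ?thesis using True by (simp add: adapted_vector_eq[OF j])
  qed (simp add: X_def)
  moreover have "j < s" if "X s j \<noteq> 0" for s j
    using that level(2)[of j] by (auto simp: X_def flag_coords_iff split: if_splits)
  ultimately show ?thesis
    using unitriangular_independent_family[OF b, of X] by (subst independent_family_cong) auto
qed

lemma independent_adapted:
  fixes b :: "nat \<Rightarrow> complex ^ 'n::finite"
  assumes "independent_family {1..d k} b"
  shows "independent_family {1..d k} (adapted_vector k d b x)"
  using independent_adapted_complement[OF assms, of k x]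
  by (rule independent_family_cong[THEN iffD1, rotated]) auto

lemma sum_adapted_complement:
  assumes "i \<in> {1..k}"
  shows "(\<Sum>j\<in>{1..d k}. c j *s (if j \<le> d i then u j else b j)) =
    (\<Sum>j\<in>{1..d i}. c j *s u j) + (\<Sum>r\<in>{d i <.. d k}. c r *s (b r :: complex ^ 'n))"
proof -
  have "{1..d k} = {1..d i} \<union> {d i <.. d k}" using d_mono[of i k] assms by auto
  then have "(\<Sum>j\<in>{1..d k}. c j *s (if j \<le> d i then u j else b j)) =
      (\<Sum>j\<in>{1..d i} \<union> {d i <.. d k}. c j *s (if j \<le> d i then u j else b j))"
    by (rule arg_cong)
  also have "\<dots> = (\<Sum>j\<in>{1..d i}. c j *s (if j \<le> d i then u j else b j)) +
      (\<Sum>j\<in>{d i <.. d k}. c j *s (if j \<le> d i then u j else b j))"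
    by (rule sum.union_disjoint) auto
  also have "\<dots> = (\<Sum>j\<in>{1..d i}. c j *s u j) + (\<Sum>r\<in>{d i <.. d k}. c r *s b r)"
    by (intro arg_cong2[where f = "(+)"] sum.cong) auto
  finally show ?thesis .
qed

text \<open>The \<open>b r\<close> with \<open>d i < r\<close> are independent modulo the
  \<open>i\<close>-th step, because together with the adapted vectors of that step they form an
  independent family.\<close>

lemma complement_coeff_unique:
  fixes b :: "nat \<Rightarrow> complex ^ 'n::finite"
  assumes b: "independent_family {1..d k} b" and i: "i \<in> {1..k}"
    and mem: "(\<Sum>r\<in>{d i <.. d k}. c r *s b r) \<in> vec.span (adapted_vector k d b x ` {1..d i})"
    and r: "r \<in> {d i <.. d k}"
  shows "c r = 0"
proof -
  obtain a where a: "(\<Sum>r\<in>{d i <.. d k}. c r *s b r) = (\<Sum>j\<in>{1..d i}. a j *s adapted_vector k d b x j)"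
    using mem by (auto simp: span_family)
  \<comment> \<open>The expansion in the step is moved to the other side, which yields a relation of
    the mixed family.\<close>
  define c' where "c' = (\<lambda>j. if j \<le> d i then - a j else c j)"
  have "(\<Sum>j\<in>{1..d k}. c' j *s (if j \<le> d i then adapted_vector k d b x j else b j)) =
      (\<Sum>j\<in>{1..d i}. (- a j) *s adapted_vector k d b x j) + (\<Sum>r\<in>{d i <.. d k}. c r *s b r)"
    unfolding sum_adapted_complement[OF i]
    by (intro arg_cong2[where f = "(+)"] sum.cong) (auto simp: c'_def)
  also have "\<dots> = 0" unfolding a by (simp add: sum_negf)
  finally have "c' r = 0"
    using independent_familyD[OF independent_adapted_complement[OF b]] r by auto
  then show ?thesis using r by (simp add: c'_def)
qed

text \<open>The same mixed family has as many members as the dimension of the space, so it spans.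
  Subtracting its \<open>b r\<close> part from \<open>v\<close> leaves a vector of the step.\<close>

lemma complement_coeff_exists:
  fixes b :: "nat \<Rightarrow> complex ^ 'n::finite"
  assumes b: "independent_family {1..d k} b" and i: "i \<in> {1..k}" and N: "d k = CARD('n)"
  shows "\<exists>c. v - (\<Sum>r\<in>{d i <.. d k}. c r *s b r) \<in> vec.span (adapted_vector k d b x ` {1..d i})"
proof -
  have "v \<in> vec.span ((\<lambda>j. if j \<le> d i then adapted_vector k d b x j else b j) ` {1..d k})"
    using span_family_UNIV[OF independent_adapted_complement[OF b, of i x]] N by simp
  then obtain c where "v = (\<Sum>j\<in>{1..d k}. c j *s (if j \<le> d i then adapted_vector k d b x j else b j))"
    unfolding span_family[OF finite_atLeastAtMost] by blast
  then have "v - (\<Sum>r\<in>{d i <.. d k}. c r *s b r) = (\<Sum>j\<in>{1..d i}. c j *s adapted_vector k d b x j)"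
    by (simp only: sum_adapted_complement[OF i]) simp
  then show ?thesis by (auto simp: span_family)
qed

section \<open>Big cells: injectivity and covering\<close>

lemma flag_param_step: "i \<in> {1..k} \<Longrightarrow> flag_param k d b x i = vec.span (adapted_vector k d b x ` {1..d i})"
  by (simp add: flag_param_def)

lemma flag_param_mono:
  "1 \<le> i \<Longrightarrow> i \<le> j \<Longrightarrow> j \<le> k \<Longrightarrow> flag_param k d b x i \<subseteq> flag_param k d b x j"
  using d_mono[of i j] by (auto simp: flag_param_step intro!: vec.span_mono image_mono)

lemma flag_param_in_flags:
  fixes b :: "nat \<Rightarrow> complex ^ 'n::finite"
  assumes b: "independent_family {1..d k} b" and N: "d k = CARD('n)"
  shows "flag_param k d b x \<in> flags k d"
proof -
  note ind = independent_adapted[OF b, of x]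
  have "vec.dim (flag_param k d b x i) = d i" if i: "i \<in> {1..k}" for i
  proof -
    have "independent_family {1..d i} (adapted_vector k d b x)"
      using ind d_mono[of i k] i by (intro independent_family_subset[OF ind]) auto
    then show ?thesis using dim_span_family i by (fastforce simp: flag_param_step)
  qed
  moreover have "flag_param k d b x k = UNIV"
    using span_family_UNIV[OF ind] N k_pos by (simp add: flag_param_step)
  moreover have "flag_param k d b x i \<subseteq> flag_param k d b x (i + 1)" if "i \<in> {1..<k}" for i
    using that by (intro flag_param_mono) auto
  moreover have "vec.subspace (flag_param k d b x i)" if "i \<in> {1..k}" for i
    by (simp only: flag_param_step[OF that] vec.subspace_span)
  moreover have "flag_param k d b x \<in> extensional {1..k}" by (simp add: flag_param_def)
  ultimately show ?thesis unfolding flags_def by blast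
qed

lemma adapted_vector_in_flag_param:
  "i \<in> {1..k} \<Longrightarrow> j \<in> {1..d i} \<Longrightarrow> adapted_vector k d b x j \<in> flag_param k d b x i"
  by (auto simp: flag_param_step intro: vec.span_base)

text \<open>For equal flags the difference of the \<open>j\<close>-th adapted vectors lies in step
  \<open>level j\<close>. It is also a combination of the \<open>b r\<close> complementary to this
  step, so its coefficients, the coordinate differences, vanish.\<close>

lemma flag_param_inj:
  fixes b :: "nat \<Rightarrow> complex ^ 'n::finite"
  assumes b: "independent_family {1..d k} b"
  shows "inj_on (flag_param k d b) (coord_space (flag_coords k d))"
proof (rule inj_onI, rule ext)
  fix x y and q :: "nat \<times> nat"
  assume x: "x \<in> coord_space (flag_coords k d)" and y: "y \<in> coord_space (flag_coords k d)"
    and eq: "flag_param k d b x = flag_param k d b y"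
  show "x q = y q"
  proof (cases "q \<in> flag_coords k d")
    case True
    obtain r j where q: "q = (r, j)" by (cases q)
    then have j: "j \<in> {1..d k}" and r: "r \<in> {d (level j) <.. d k}"
      using True by (auto simp: flag_coords_iff)
    note l = level[OF j]
    have "adapted_vector k d b x j - adapted_vector k d b y j \<in> flag_param k d b x (level j)"
      using l j adapted_vector_in_flag_param[of "level j" j b x]
        adapted_vector_in_flag_param[of "level j" j b y]
      unfolding eq[symmetric] flag_param_step[OF l(1)] by (auto intro: vec.span_diff)
    also have "adapted_vector k d b x j - adapted_vector k d b y j =
        (\<Sum>r\<in>{d (level j) <.. d k}. (x (r, j) - y (r, j)) *s b r)"
      by (simp add: adapted_vector_eq[OF j] vec.scale_left_diff_distrib sum_subtractf)
    finally have "x (r, j) - y (r, j) = 0"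
      unfolding flag_param_step[OF l(1)]
      by (rule complement_coeff_unique[OF b l(1) _ r, where c = "\<lambda>r. x (r, j) - y (r, j)"])
    then show ?thesis by (simp add: q)
  qed (use x y in \<open>cases q, simp add: coord_space_def\<close>)
qed

text \<open>With an adapted basis of \<open>V\<close> as \<open>b\<close>, the flag is the origin of
  its own cell.\<close>

lemma flag_param_surj:
  fixes V :: "'n::finite flag"
  assumes V: "V \<in> flags k d"
  obtains b where "independent_family {1..d k} b" "flag_param k d b (\<lambda>_. 0) = V"
proof -
  obtain w where w: "independent_family {1..d k} w" "\<And>i. i \<in> {1..k} \<Longrightarrow> V i = vec.span (w ` {1..d i})"
    using adapted_basis_exists[OF V k_pos] by blast
  have "flag_param k d w (\<lambda>_. 0) = V"
    using flagsD(5)[OF V] w(2)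
    by (intro extensionalityI[of _ "{1..k}"]) (auto simp: flag_param_def adapted_vector_def)
  then show thesis using that w(1) by blast
qed

text \<open>The vectors sent by the difference of \<open>S\<close> and \<open>T\<close> into a given
  step form a subspace, so basis vectors suffice. As the steps increase, the \<open>j\<close>-th one
  need only be tested in step \<open>level j\<close>; for \<open>level j = k\<close> the test is
  void, the last step being the whole space.\<close>

lemma E_map_eq_on_adapted:
  fixes b b' :: "nat \<Rightarrow> complex ^ 'n::finite"
  assumes b: "independent_family {1..d k} b" and b': "independent_family {1..d k} b'"
    and N: "d k = CARD('n)"
  shows "E_map k (flag_param k d b x, flag_param k d b' y) S = E_map k (flag_param k d b x, flag_param k d b' y) T \<longleftrightarrow>
    (\<forall>j\<in>{1..d k}. S *v adapted_vector k d b' y j - T *v adapted_vector k d b' y j \<in> flag_param k d b x (level j))"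
    (is "?lhs \<longleftrightarrow> ?rhs")
proof -
  note z = flag_param_in_flags[OF b N, of x] and \<zeta> = flag_param_in_flags[OF b' N, of y]
  have "?lhs \<longleftrightarrow> (\<forall>i\<in>{1..<k}. \<forall>v\<in>flag_param k d b' y i. S *v v - T *v v \<in> flag_param k d b x i)"
    by (rule E_map_eq_iff[OF z \<zeta>])
  also have "\<dots> \<longleftrightarrow> ?rhs"
  proof (intro iffI ballI)
    fix j assume *: "\<forall>i\<in>{1..<k}. \<forall>v\<in>flag_param k d b' y i. S *v v - T *v v \<in> flag_param k d b x i"
      and j: "j \<in> {1..d k}"
    show "S *v adapted_vector k d b' y j - T *v adapted_vector k d b' y j \<in> flag_param k d b x (level j)"
    proof (cases "level j = k")
      case True
      then show ?thesis by (simp add: flagsD(4)[OF z])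
    next
      case False
      then have "level j \<in> {1..<k}" using level[OF j] by auto
      then show ?thesis
        using * adapted_vector_in_flag_param[OF level(1)[OF j], of j b' y] level(2)[OF j] j
        unfolding atLeastAtMost_iff by blast
    qed
  next
    fix i v assume *: ?rhs and i: "i \<in> {1..<k}" and v: "v \<in> flag_param k d b' y i"
    have sub: "vec.subspace (flag_param k d b x i)" using flagsD(1)[OF z] i by simp
    have "vec.subspace {v. S *v v - T *v v \<in> flag_param k d b x i}"
    proof (rule vec.subspaceI)
      fix u v assume "u \<in> {v. S *v v - T *v v \<in> flag_param k d b x i}"
        "v \<in> {v. S *v v - T *v v \<in> flag_param k d b x i}"
      then have "(S *v u - T *v u) + (S *v v - T *v v) \<in> flag_param k d b x i"
        using vec.subspace_add[OF sub] by simp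
      then show "u + v \<in> {v. S *v v - T *v v \<in> flag_param k d b x i}"
        by (simp add: matrix_vector_right_distrib algebra_simps)
    next
      fix c v assume "v \<in> {v. S *v v - T *v v \<in> flag_param k d b x i}"
      then have "c *s (S *v v - T *v v) \<in> flag_param k d b x i"
        by (intro vec.subspace_scale[OF sub]) simp
      then show "c *s v \<in> {v. S *v v - T *v v \<in> flag_param k d b x i}"
        by (simp add: vec.linear_scale vec.scale_right_diff_distrib)
    qed (simp add: vec.subspace_0[OF sub])
    moreover have "adapted_vector k d b' y ` {1..d i} \<subseteq> {v. S *v v - T *v v \<in> flag_param k d b x i}"
    proof (rule image_subsetI)
      fix j assume "j \<in> {1..d i}"
      then have j: "j \<in> {1..d k}" "j \<le> d i" using d_mono[of i k] i by auto
      then have "level j \<le> i" using le_d_iff_level_le[of j i] i by auto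
      then have "flag_param k d b x (level j) \<subseteq> flag_param k d b x i"
        using level(1)[OF j(1)] i by (intro flag_param_mono) auto
      then show "adapted_vector k d b' y j \<in> {v. S *v v - T *v v \<in> flag_param k d b x i}"
        using * j(1) by blast
    qed
    ultimately have "vec.span (adapted_vector k d b' y ` {1..d i}) \<subseteq> {v. S *v v - T *v v \<in> flag_param k d b x i}"
      by (intro vec.span_minimal)
    then show "S *v v - T *v v \<in> flag_param k d b x i"
      using v i by (auto simp: flag_param_step)
  qed
  finally show ?thesis .
qed

section \<open>Matrix units and a basis of each fibre\<close>

definition elementary_on :: "(nat \<Rightarrow> complex ^ 'n) \<Rightarrow> (nat \<Rightarrow> complex ^ 'n) \<Rightarrow> (nat \<times> nat \<Rightarrow> complex ^ 'n ^ 'n) \<Rightarrow> bool" where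
  "elementary_on b w A \<longleftrightarrow>
     (\<forall>r j. (r, j) \<in> flag_coords k d \<longrightarrow> (\<forall>j'\<in>{1..d k}. A (r, j) *v w j' = (if j' = j then b r else 0)))"

lemma elementary_on_exists:
  fixes w :: "nat \<Rightarrow> complex ^ 'n::finite"
  assumes "independent_family {1..d k} w"
  obtains A where "elementary_on b w A"
proof -
  have "\<exists>A :: complex ^ 'n ^ 'n. \<forall>j'\<in>{1..d k}. A *v w j' = (if j' = snd q then b (fst q) else 0)" for q :: "nat \<times> nat"
    using matrix_on_family[OF assms finite_atLeastAtMost, of "\<lambda>j'. if j' = snd q then b (fst q) else 0"]
    by metis
  then obtain A :: "nat \<times> nat \<Rightarrow> complex ^ 'n ^ 'n"
    where "\<And>q. \<forall>j'\<in>{1..d k}. A q *v w j' = (if j' = snd q then b (fst q) else 0)" by metis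
  then have "elementary_on b w A" by (simp add: elementary_on_def)
  then show thesis by (rule that)
qed

text \<open>On \<open>w j\<close> only the matrix units of column \<open>j\<close>
  contribute.\<close>

lemma elementary_combination:
  fixes A :: "nat \<times> nat \<Rightarrow> complex ^ 'n ^ 'n"
  assumes A: "elementary_on b w A" and j: "j \<in> {1..d k}"
  shows "(\<Sum>q\<in>flag_coords k d. mat_scale (c q) (A q)) *v w j = (\<Sum>r\<in>{d (level j) <.. d k}. c (r, j) *s b r)"
proof -
  have "(\<Sum>q\<in>flag_coords k d. mat_scale (c q) (A q)) *v w j =
      (\<Sum>q\<in>flag_coords k d. c q *s (if j = snd q then b (fst q) else 0))"
    using A j by (auto simp: sum_matrix_vector_mult elementary_on_def intro!: sum.cong)
  also have "\<dots> = (\<Sum>q\<in>(\<lambda>r. (r, j)) ` {d (level j) <.. d k}. c q *s b (fst q))"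
    using j finite_flag_coords by (intro sum.mono_neutral_cong_right) (auto simp: flag_coords_iff image_iff)
  also have "\<dots> = (\<Sum>r\<in>{d (level j) <.. d k}. c (r, j) *s b r)"
    by (subst sum.reindex) (auto simp: inj_on_def)
  finally show ?thesis .
qed

text \<open>A class amounts to a choice, for every \<open>j\<close>, of a vector modulo step
  \<open>level j\<close> of the first flag, and the complementary \<open>b r\<close> induce a basis
  of that quotient. Coefficients thus exist and are unique column by column; \<open>g\<close> only
  numbers the coordinates.\<close>

lemma E_fibre_basis:
  fixes b b' :: "nat \<Rightarrow> complex ^ 'n::finite" and n :: nat
  assumes b: "independent_family {1..d k} b" and b': "independent_family {1..d k} b'"
    and N: "d k = CARD('n)" and g: "bij_betw g {..<n} (flag_coords k d)"
    and A: "elementary_on b (adapted_vector k d b' y) A"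
    and p: "p = (flag_param k d b x, flag_param k d b' y)"
  shows "is_basis (E_fibre k p) {..<n} (\<lambda>m. E_map k p (A (g m)))"
proof -
  interpret module_image mat_scale "E_map k p" "E_fibre k p"
    using flag_param_in_flags[OF b N] flag_param_in_flags[OF b' N] k_pos
    by (intro E_fibre_image[of _ _ d]) (auto simp: p)
  \<comment> \<open>The inverse numbering rewrites coefficients indexed by \<open>m\<close> as
    coefficients indexed by coordinates.\<close>
  define h where "h = the_inv_into {..<n} g"
  have h: "h (g m) = m" if "m < n" for m
    using g that unfolding h_def bij_betw_def by (intro the_inv_into_f_f) auto
  have reindex: "(\<Sum>m\<in>{..<n}. mat_scale (c m) (A (g m))) = (\<Sum>q\<in>flag_coords k d. mat_scale (c (h q)) (A q))" for c
    using sum.reindex_bij_betw[OF g, of "\<lambda>q. mat_scale (c (h q)) (A q)"] by (simp add: h)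
  show ?thesis
  proof (rule is_basis_image)
    fix T :: "complex ^ 'n ^ 'n"
    have "\<exists>c. T *v adapted_vector k d b' y j - (\<Sum>r\<in>{d (level j) <.. d k}. c r *s b r)
        \<in> flag_param k d b x (level j)" if "j \<in> {1..d k}" for j
      using complement_coeff_exists[OF b level(1)[OF that] N, of _ x] level(1)[OF that]
      by (simp add: flag_param_step)
    then obtain C where C: "\<And>j. j \<in> {1..d k} \<Longrightarrow> T *v adapted_vector k d b' y j - (\<Sum>r\<in>{d (level j) <.. d k}. C j r *s b r)
        \<in> flag_param k d b x (level j)" by metis
    define c where "c = (\<lambda>q. C (snd q) (fst q))"
    have "E_map k p T = E_map k p (\<Sum>q\<in>flag_coords k d. mat_scale (c q) (A q))"
      unfolding p E_map_eq_on_adapted[OF b b' N] using C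
      by (simp add: elementary_combination[OF A] c_def)
    also have "(\<Sum>q\<in>flag_coords k d. mat_scale (c q) (A q)) = (\<Sum>m\<in>{..<n}. mat_scale (c (g m)) (A (g m)))"
      by (rule sum.reindex_bij_betw[OF g, symmetric])
    finally show "\<exists>c. E_map k p T = E_map k p (\<Sum>m\<in>{..<n}. mat_scale (c m) (A (g m)))"
      by (intro exI[of _ "\<lambda>m. c (g m)"])
  next
    fix c m assume eq: "E_map k p (\<Sum>m\<in>{..<n}. mat_scale (c m) (A (g m))) = E_map k p 0" and m: "m \<in> {..<n}"
    obtain r j where rj: "g m = (r, j)" by (cases "g m")
    have "(r, j) \<in> flag_coords k d" using g m unfolding bij_betw_def by (auto simp flip: rj)
    then have j: "j \<in> {1..d k}" and r: "r \<in> {d (level j) <.. d k}" by (auto simp: flag_coords_iff)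
    have "(\<Sum>r\<in>{d (level j) <.. d k}. c (h (r, j)) *s b r) \<in> flag_param k d b x (level j)"
      using eq j unfolding p E_map_eq_on_adapted[OF b b' N] reindex
      by (simp add: elementary_combination[OF A])
    then have "c (h (r, j)) = 0"
      using complement_coeff_unique[OF b level(1)[OF j] _ r, of "\<lambda>r. c (h (r, j))"] level(1)[OF j]
      by (simp add: flag_param_step)
    then show "c m = 0" using h m by (simp flip: rj)
  qed simp
qed

text \<open>On the diagonal chart both factors use the same \<open>b\<close>. Modulo the step of the first flag,
  \<open>b j \<equiv> - (\<Sum>r. x (r, j) *s b r)\<close>; hence the \<open>j\<close>-th vector of the second flag is
  \<open>\<Sum>r. (y (r, j) - x (r, j)) *s b r\<close> there.\<close>

lemma eta_in_frame:
  fixes b :: "nat \<Rightarrow> complex ^ 'n::finite" and n :: nat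
  assumes b: "independent_family {1..d k} b"
    and N: "d k = CARD('n)" and g: "bij_betw g {..<n} (flag_coords k d)"
    and A: "elementary_on b (adapted_vector k d b y) A"
    and p: "p = (flag_param k d b x, flag_param k d b y)"
  shows "eta k p = (\<Oplus>\<^bsub>E_fibre k p\<^esub>m\<in>{..<n}. (y (g m) - x (g m)) \<odot>\<^bsub>E_fibre k p\<^esub> E_map k p (A (g m)))"
proof -
  interpret module_image mat_scale "E_map k p" "E_fibre k p"
    using flag_param_in_flags[OF b N] k_pos by (intro E_fibre_image[of _ _ d]) (auto simp: p)
  have "adapted_vector k d b y j - (\<Sum>r\<in>{d (level j) <.. d k}. (y (r, j) - x (r, j)) *s b r) = adapted_vector k d b x j"
    if "j \<in> {1..d k}" for j
    by (simp add: adapted_vector_eq[OF that] vec.scale_left_diff_distrib sum_subtractf)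
  then have "E_map k p (mat 1) = E_map k p (\<Sum>q\<in>flag_coords k d. mat_scale (y q - x q) (A q))"
    unfolding p E_map_eq_on_adapted[OF b b N]
    using level by (simp add: elementary_combination[OF A] adapted_vector_in_flag_param)
  also have "(\<Sum>q\<in>flag_coords k d. mat_scale (y q - x q) (A q)) = (\<Sum>m\<in>{..<n}. mat_scale (y (g m) - x (g m)) (A (g m)))"
    by (rule sum.reindex_bij_betw[OF g, symmetric])
  finally show ?thesis by (simp only: finsum_image eta_eq_E_map finite_lessThan)
qed

end


section \<open>Holomorphic functions on charts\<close>

lemma holomorphic_in_coords_const:
  "openin (top_of_set (coord_space I)) D \<Longrightarrow> holomorphic_in_coords I D (\<lambda>_. c)"
  by (simp add: holomorphic_in_coords_def)

lemma holomorphic_in_coords_coordinate: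
  assumes "openin (top_of_set (coord_space I)) D"
  shows "holomorphic_in_coords I D (\<lambda>x. x i)"
  unfolding holomorphic_in_coords_def
proof (intro conjI ballI)
  show "continuous_on D (\<lambda>x. x i)"
    by (rule continuous_on_subset[OF continuous_on_product_coordinates]) simp
  fix x i' assume "x \<in> D" "i' \<in> I"
  show "(\<lambda>t. (x(i' := t)) i) holomorphic_on {t. x(i' := t) \<in> D}"
    by (cases "i = i'") (auto intro!: holomorphic_intros)
qed (rule assms)

lemma holomorphic_in_coords_add:
  "holomorphic_in_coords I D f \<Longrightarrow> holomorphic_in_coords I D g \<Longrightarrow> holomorphic_in_coords I D (\<lambda>x. f x + g x)"
  by (auto simp: holomorphic_in_coords_def intro!: continuous_intros holomorphic_intros)

lemma holomorphic_in_coords_diff: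
  "holomorphic_in_coords I D f \<Longrightarrow> holomorphic_in_coords I D g \<Longrightarrow> holomorphic_in_coords I D (\<lambda>x. f x - g x)"
  by (auto simp: holomorphic_in_coords_def intro!: continuous_intros holomorphic_intros)

lemma holomorphic_in_coords_mult:
  "holomorphic_in_coords I D f \<Longrightarrow> holomorphic_in_coords I D g \<Longrightarrow> holomorphic_in_coords I D (\<lambda>x. f x * g x)"
  by (auto simp: holomorphic_in_coords_def intro!: continuous_intros holomorphic_intros)

lemma holomorphic_in_coords_sum:
  assumes "openin (top_of_set (coord_space I)) D" "\<And>j. j \<in> J \<Longrightarrow> holomorphic_in_coords I D (f j)"
  shows "holomorphic_in_coords I D (\<lambda>x. \<Sum>j\<in>J. f j x)"
  using assms(2)
  by (induction J rule: infinite_finite_induct)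
    (auto intro: holomorphic_in_coords_const[OF assms(1)] holomorphic_in_coords_add)

lemma holomorphic_in_coords_cong:
  assumes "\<And>x. x \<in> D \<Longrightarrow> f x = g x"
  shows "holomorphic_in_coords I D f \<longleftrightarrow> holomorphic_in_coords I D g"
proof -
  have "continuous_on D f \<longleftrightarrow> continuous_on D g"
    using assms by (intro continuous_on_cong) auto
  moreover have "(\<lambda>t. f (x(i := t))) holomorphic_on {t. x(i := t) \<in> D} \<longleftrightarrow>
      (\<lambda>t. g (x(i := t))) holomorphic_on {t. x(i := t) \<in> D}" for x i
    using assms by (intro holomorphic_cong) auto
  ultimately show ?thesis by (simp add: holomorphic_in_coords_def)
qed

lemma mfd_open_chart:
  assumes "(D, \<psi>) \<in> params M" "openin (top_of_set (coord_space (coords M))) D" "\<psi> ` D \<subseteq> points M"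
  shows "mfd_open M (\<psi> ` D)"
  using assms unfolding mfd_open_def local_param_def by blast

text \<open>One chart serves as the local parametrization at every point of its image.\<close>

lemma mfd_holomorphic_chart:
  assumes "(D, \<psi>) \<in> params M" "\<psi> ` D \<subseteq> points M" "holomorphic_in_coords (coords M) D (f \<circ> \<psi>)"
  shows "mfd_holomorphic M (\<psi> ` D) f"
proof -
  have D: "openin (top_of_set (coord_space (coords M))) D"
    using assms(3) by (simp add: holomorphic_in_coords_def)
  have "local_param M D \<psi> x (\<psi> x)" if "x \<in> D" for x
    using assms(1) D that by (auto simp: local_param_def)
  then show ?thesis
    using mfd_open_chart[OF assms(1) D assms(2)] assms(3) unfolding mfd_holomorphic_def by blast
qed


section \<open>The product of two big cells\<close>

context flag_type
begin

text \<open>The chart inverse to \<open>flag_param\<close>. Frames and coefficient functions depend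
  on points of the manifold, so the coordinates must be recovered from the flag; the values are
  meaningful only on the cell.\<close>

definition cell_coords :: "(nat \<Rightarrow> complex ^ 'n::finite) \<Rightarrow> 'n flag \<Rightarrow> nat \<times> nat \<Rightarrow> complex" where
  "cell_coords b = the_inv_into (coord_space (flag_coords k d)) (flag_param k d b)"

lemma cell_coords_flag_param:
  "independent_family {1..d k} b \<Longrightarrow> x \<in> coord_space (flag_coords k d) \<Longrightarrow>
    cell_coords b (flag_param k d b x) = x"
  unfolding cell_coords_def by (intro the_inv_into_f_f flag_param_inj)

definition pair_domain :: "((nat \<times> nat) + (nat \<times> nat) \<Rightarrow> complex) set" where
  "pair_domain = coord_space (flag_coords k d <+> flag_coords k d)"

definition pair_param ::
    "(nat \<Rightarrow> complex ^ 'n::finite) \<Rightarrow> (nat \<Rightarrow> complex ^ 'n) \<Rightarrow> ((nat \<times> nat) + (nat \<times> nat) \<Rightarrow> complex) \<Rightarrow> 'n flag \<times> 'n flag" where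
  "pair_param b b' x = (flag_param k d b (x \<circ> Inl), flag_param k d b' (x \<circ> Inr))"

definition pair_cell :: "(nat \<Rightarrow> complex ^ 'n::finite) \<Rightarrow> (nat \<Rightarrow> complex ^ 'n) \<Rightarrow> ('n flag \<times> 'n flag) set" where
  "pair_cell b b' = pair_param b b' ` pair_domain"

abbreviation XX :: "((nat \<times> nat) + (nat \<times> nat), 'n::finite flag \<times> 'n flag) manifold" where
  "XX \<equiv> mfd_prod (flag_manifold k d) (flag_manifold k d)"

lemma points_XX: "points (XX :: (_, 'n::finite flag \<times> 'n flag) manifold) = flags k d \<times> flags k d"
  and coords_XX: "coords (XX :: (_, 'n flag \<times> 'n flag) manifold) = flag_coords k d <+> flag_coords k d"
  by (simp_all add: mfd_prod_def flag_manifold_def)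

lemma pair_domain_iff:
  "x \<in> pair_domain \<longleftrightarrow> x \<circ> Inl \<in> coord_space (flag_coords k d) \<and> x \<circ> Inr \<in> coord_space (flag_coords k d)"
proof -
  have "(\<forall>i. i \<notin> A <+> B \<longrightarrow> x i = 0) \<longleftrightarrow> (\<forall>i. i \<notin> A \<longrightarrow> x (Inl i) = 0) \<and> (\<forall>i. i \<notin> B \<longrightarrow> x (Inr i) = 0)"
    for A B :: "(nat \<times> nat) set"
    by (auto simp: split_sum_all)
  then show ?thesis by (simp add: pair_domain_def coord_space_def)
qed

lemma openin_pair_domain:
  "openin (top_of_set (coord_space (coords (XX :: (_, 'n::finite flag \<times> 'n flag) manifold)))) pair_domain"
  by (simp add: coords_XX pair_domain_def)

lemma pair_param_in_params:
  fixes b b' :: "nat \<Rightarrow> complex ^ 'n::finite"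
  assumes "independent_family {1..d k} b" "independent_family {1..d k} b'" "d k = CARD('n)"
  shows "(pair_domain, pair_param b b') \<in> params XX"
proof -
  have "(coord_space (flag_coords k d), flag_param k d b) \<in> params (flag_manifold k d)"
    "(coord_space (flag_coords k d), flag_param k d b') \<in> params (flag_manifold k d)"
    using assms by (auto simp: flag_manifold_def independent_family_iff)
  moreover have "pair_domain = {x. x \<circ> Inl \<in> coord_space (flag_coords k d) \<and> x \<circ> Inr \<in> coord_space (flag_coords k d)}"
    using pair_domain_iff by blast
  moreover have "pair_param b b' = (\<lambda>x. (flag_param k d b (x \<circ> Inl), flag_param k d b' (x \<circ> Inr)))"
    by (simp add: pair_param_def fun_eq_iff)
  ultimately show ?thesis unfolding mfd_prod_def by auto
qed

lemma pair_cell_subset: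
  fixes b b' :: "nat \<Rightarrow> complex ^ 'n::finite"
  assumes "independent_family {1..d k} b" "independent_family {1..d k} b'" "d k = CARD('n)"
  shows "pair_cell b b' \<subseteq> flags k d \<times> flags k d"
  using assms flag_param_in_flags by (auto simp: pair_cell_def pair_param_def)

lemma mfd_open_pair_cell:
  fixes b b' :: "nat \<Rightarrow> complex ^ 'n::finite"
  assumes "independent_family {1..d k} b" "independent_family {1..d k} b'" "d k = CARD('n)"
  shows "mfd_open XX (pair_cell b b')"
  unfolding pair_cell_def
  using pair_param_in_params[OF assms] pair_cell_subset[OF assms]
  by (intro mfd_open_chart openin_pair_domain) (auto simp: pair_cell_def points_XX)

text \<open>Each factor is placed at the origin of a cell of its own.\<close>

lemma pair_cell_cover:
  fixes p :: "'n::finite flag \<times> 'n flag"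
  assumes "p \<in> flags k d \<times> flags k d"
  obtains b b' where "independent_family {1..d k} b" "independent_family {1..d k} b'"
    "p \<in> pair_cell b b'"
proof -
  obtain z \<zeta> where p: "p = (z, \<zeta>)" and z: "z \<in> flags k d" and \<zeta>: "\<zeta> \<in> flags k d"
    using assms by auto
  obtain b where b: "independent_family {1..d k} b" "flag_param k d b (\<lambda>_. 0) = z"
    using flag_param_surj[OF z] by blast
  obtain b' where b': "independent_family {1..d k} b'" "flag_param k d b' (\<lambda>_. 0) = \<zeta>"
    using flag_param_surj[OF \<zeta>] by blast
  have "p = pair_param b b' (\<lambda>_. 0)" "(\<lambda>_. 0) \<in> pair_domain"
    using b b' by (simp_all add: p pair_param_def pair_domain_def coord_space_def o_def)
  then show thesis using that b(1) b'(1) unfolding pair_cell_def by blast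
qed

lemma mfd_open_points:
  assumes "d k = CARD('n)"
  shows "mfd_open XX (flags k d \<times> flags k d :: ('n::finite flag \<times> 'n flag) set)"
  unfolding mfd_open_def
proof (intro conjI ballI)
  fix p :: "'n flag \<times> 'n flag" assume p: "p \<in> flags k d \<times> flags k d"
  obtain b b' where b: "independent_family {1..d k} b" "independent_family {1..d k} b'" "p \<in> pair_cell b b'"
    using pair_cell_cover[OF p] by blast
  then have "\<exists>D \<psi> x. local_param XX D \<psi> x p \<and> \<psi> ` D \<subseteq> pair_cell b b'"
    using mfd_open_pair_cell[OF b(1,2) assms] by (simp add: mfd_open_def)
  then show "\<exists>D \<psi> x. local_param XX D \<psi> x p \<and> \<psi> ` D \<subseteq> flags k d \<times> flags k d"
    using pair_cell_subset[OF b(1,2) assms] by blast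
qed (simp add: points_XX)

section \<open>Adapted bases as holomorphic frames\<close>

definition frame_vector :: "(nat \<Rightarrow> complex ^ 'n::finite) \<Rightarrow> 'n flag \<times> 'n flag \<Rightarrow> nat \<Rightarrow> complex ^ 'n" where
  "frame_vector b' q = adapted_vector k d b' (cell_coords b' (snd q))"

lemma frame_vector_pair_param:
  "independent_family {1..d k} b' \<Longrightarrow> x \<in> pair_domain \<Longrightarrow>
    frame_vector b' (pair_param b b' x) = adapted_vector k d b' (x \<circ> Inr)"
  by (simp add: frame_vector_def pair_param_def cell_coords_flag_param pair_domain_iff)

lemma mfd_holomorphic_vec_pair_cell:
  fixes b b' :: "nat \<Rightarrow> complex ^ 'n::finite"
  assumes "independent_family {1..d k} b" "independent_family {1..d k} b'" "d k = CARD('n)"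
    and "\<And>i. holomorphic_in_coords (flag_coords k d <+> flag_coords k d) pair_domain (\<lambda>x. f (pair_param b b' x) $ i)"
  shows "mfd_holomorphic_vec XX (pair_cell b b') f"
  unfolding mfd_holomorphic_vec_def pair_cell_def
  using pair_param_in_params[OF assms(1-3)] pair_cell_subset[OF assms(1-3)] assms(4)
  by (intro allI mfd_holomorphic_chart) (auto simp: pair_cell_def points_XX coords_XX o_def)

lemma mfd_holomorphic_vec_const:
  fixes b b' :: "nat \<Rightarrow> complex ^ 'n::finite" and v :: "complex ^ 'n"
  assumes "independent_family {1..d k} b" "independent_family {1..d k} b'" "d k = CARD('n)"
  shows "mfd_holomorphic_vec XX (pair_cell b b') (\<lambda>_. v)"
  using openin_pair_domain
  by (intro mfd_holomorphic_vec_pair_cell[OF assms] holomorphic_in_coords_const)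
    (simp add: coords_XX)

text \<open>In the chart, the components are affine functions of the coordinates of the second
  factor.\<close>

lemma mfd_holomorphic_vec_frame_vector:
  fixes b b' :: "nat \<Rightarrow> complex ^ 'n::finite"
  assumes "independent_family {1..d k} b" "independent_family {1..d k} b'" "d k = CARD('n)"
    and j: "j \<in> {1..d k}"
  shows "mfd_holomorphic_vec XX (pair_cell b b') (\<lambda>q. frame_vector b' q j)"
proof (rule mfd_holomorphic_vec_pair_cell[OF assms(1-3)])
  fix i
  have D: "openin (top_of_set (coord_space (flag_coords k d <+> flag_coords k d))) pair_domain"
    using openin_pair_domain by (simp add: coords_XX)
  have "holomorphic_in_coords (flag_coords k d <+> flag_coords k d) pair_domain
      (\<lambda>x. b' j $ i + (\<Sum>r\<in>{d (level j) <.. d k}. x (Inr (r, j)) * b' r $ i))"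
    by (intro holomorphic_in_coords_add holomorphic_in_coords_mult holomorphic_in_coords_sum
        holomorphic_in_coords_const holomorphic_in_coords_coordinate D)
  then show "holomorphic_in_coords (flag_coords k d <+> flag_coords k d) pair_domain
      (\<lambda>x. frame_vector b' (pair_param b b' x) j $ i)"
    by (rule holomorphic_in_coords_cong[THEN iffD1, rotated])
      (simp add: frame_vector_pair_param[OF assms(2)] adapted_vector_eq[OF j] o_def)
qed

lemma independent_frame_vector:
  fixes b' :: "nat \<Rightarrow> complex ^ 'n::finite"
  assumes "independent_family {1..d k} b'"
  shows "independent_family {1..d k} (frame_vector b' q)"
  unfolding frame_vector_def by (rule independent_adapted[OF assms])

lemma span_frame_vector:
  fixes b' :: "nat \<Rightarrow> complex ^ 'n::finite"
  assumes "independent_family {1..d k} b'" and q: "q \<in> pair_cell b b'" and "i \<in> {1..k}"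
  shows "vec.span (frame_vector b' q ` {1..d i}) = snd q i"
  using assms
  by (auto simp: pair_cell_def frame_vector_pair_param) (simp_all add: pair_param_def flag_param_step)

lemma hol_subspace_frame_vector:
  fixes b b' :: "nat \<Rightarrow> complex ^ 'n::finite"
  assumes b: "independent_family {1..d k} b" "independent_family {1..d k} b'" "d k = CARD('n)"
    and i: "i \<in> {1..k}"
  shows "hol_subspace_frame XX (pair_cell b b') (\<lambda>(z, \<zeta>). \<zeta> i) (d i) (\<lambda>j q. frame_vector b' q (Suc j))"
  unfolding hol_subspace_frame_def
proof (intro conjI allI impI ballI)
  have le: "d i \<le> d k" using d_mono[of i k] i by auto
  fix j assume "j < d i"
  then show "mfd_holomorphic_vec XX (pair_cell b b') (\<lambda>q. frame_vector b' q (Suc j))"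
    using le by (intro mfd_holomorphic_vec_frame_vector[OF b]) auto
next
  have le: "d i \<le> d k" using d_mono[of i k] i by auto
  fix q assume q: "q \<in> pair_cell b b'"
  have "independent_family {1..d i} (frame_vector b' q)"
    using le by (intro independent_family_subset[OF independent_frame_vector[OF b(2)]]) auto
  then have ind: "inj_on (frame_vector b' q) {1..d i}" "vec.independent (frame_vector b' q ` {1..d i})"
    by (simp_all add: independent_family_iff)
  \<comment> \<open>Frames are numbered from 0, columns from 1.\<close>
  have im: "Suc ` {..<d i} = {1..d i}" by (simp add: lessThan_atLeast0 image_Suc_atLeastLessThan atLeastLessThanSuc_atLeastAtMost)
  have im': "(\<lambda>j. frame_vector b' q (Suc j)) ` {..<d i} = frame_vector b' q ` {1..d i}"
    unfolding im[symmetric] image_image ..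
  show "inj_on (\<lambda>j. frame_vector b' q (Suc j)) {..<d i}"
    using comp_inj_on[of Suc "{..<d i}" "frame_vector b' q"] ind(1) by (simp add: im[simplified] o_def)
  show "vec.independent ((\<lambda>j. frame_vector b' q (Suc j)) ` {..<d i})"
    unfolding im' by (rule ind(2))
  show "vec.span ((\<lambda>j. frame_vector b' q (Suc j)) ` {..<d i}) = (case q of (z, \<zeta>) \<Rightarrow> \<zeta> i)"
    unfolding im' span_frame_vector[OF b(2) q i] by (simp add: case_prod_unfold)
qed

text \<open>The vectors \<open>T q *v frame_vector b' q j\<close> lift the values of the section on
  the frame of each step of the second flag. Their holomorphy is what the definition of holomorphic
  Hom sections asks for.\<close>

lemma hol_section_E_map:
  fixes W :: "('n::finite flag \<times> 'n flag) set"
  assumes N: "d k = CARD('n)" and W: "mfd_open XX W"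
    and cells: "\<And>p. p \<in> W \<Longrightarrow> \<exists>b b'. independent_family {1..d k} b \<and> independent_family {1..d k} b' \<and>
      p \<in> pair_cell b b' \<and> pair_cell b b' \<subseteq> W \<and>
      (\<forall>j\<in>{1..d k}. mfd_holomorphic_vec XX (pair_cell b b') (\<lambda>q. T q *v frame_vector b' q j))"
  shows "hol_section (E_bundle k d) W (\<lambda>q. E_map k q (T q))"
proof -
  have W_sub: "W \<subseteq> flags k d \<times> flags k d"
    using W unfolding mfd_open_def points_XX by blast
  have in_E: "E_map k p (T p) \<in> carrier (E_fibre k p)" if "p \<in> W" for p
    using module_image.carrier_image[OF E_fibre_image[OF _ k_pos]] W_sub that by blast
  have "hol_hom_section XX W (\<lambda>(z, \<zeta>). \<zeta> i) (\<lambda>(z, \<zeta>). z i) (\<lambda>p. E_map k p (T p) i)"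
    if i: "i \<in> {1..<k}" for i
    unfolding hol_hom_section_def
  proof (intro conjI ballI W)
    fix p assume p: "p \<in> W"
    show "E_map k p (T p) i \<in> carrier (hom_space (case p of (z, \<zeta>) \<Rightarrow> \<zeta> i) (quotient_space (case p of (z, \<zeta>) \<Rightarrow> z i)))"
      using induced_map_in_hom_space[OF flagsD(1) flagsD(1)] W_sub p i
      by (fastforce simp: E_map_def)
    obtain b b' where b: "independent_family {1..d k} b" "independent_family {1..d k} b'"
      and cell: "p \<in> pair_cell b b'" "pair_cell b b' \<subseteq> W"
      and hol: "\<forall>j\<in>{1..d k}. mfd_holomorphic_vec XX (pair_cell b b') (\<lambda>q. T q *v frame_vector b' q j)"
      using cells[OF p] by blast
    note open_cell = mfd_open_pair_cell[OF b N]
    have i': "i \<in> {1..k}" using i by simp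
    have "hol_quotient_section XX (pair_cell b b') (\<lambda>(z, \<zeta>). z i)
        (\<lambda>q. E_map k q (T q) i (frame_vector b' q (Suc j)))" if j: "j < d i" for j
    proof -
      have "E_map k q (T q) i (frame_vector b' q (Suc j)) =
          coset (case q of (z, \<zeta>) \<Rightarrow> z i) (T q *v frame_vector b' q (Suc j))"
        if q: "q \<in> pair_cell b b'" for q
      proof -
        have "frame_vector b' q (Suc j) \<in> snd q i"
          using j unfolding span_frame_vector[OF b(2) q i', symmetric] by (intro vec.span_base) auto
        then show ?thesis using i by (simp add: E_map_def induced_map_def case_prod_unfold)
      qed
      moreover have "mfd_holomorphic_vec XX (pair_cell b b') (\<lambda>q. T q *v frame_vector b' q (Suc j))"
        using hol j d_mono[of i k] i' by auto
      ultimately show ?thesis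
        unfolding hol_quotient_section_def using open_cell by blast
    qed
    then show "\<exists>W' m h. mfd_open XX W' \<and> p \<in> W' \<and> W' \<subseteq> W \<and>
        hol_subspace_frame XX W' (\<lambda>(z, \<zeta>). \<zeta> i) m h \<and>
        (\<forall>j<m. hol_quotient_section XX W' (\<lambda>(z, \<zeta>). z i) (\<lambda>q. E_map k q (T q) i (h j q)))"
      using open_cell cell hol_subspace_frame_vector[OF b N i'] by blast
  qed
  then show ?thesis using W in_E by (simp add: E_bundle_def Let_def)
qed

section \<open>The local frame of E\<close>

lemma fibre_E_bundle: "fibre (E_bundle k d) = E_fibre k"
  by (simp add: E_bundle_def Let_def)

text \<open>A pointwise choice is harmless: for indices in \<open>flag_coords k d\<close>,
  \<open>elementary_on\<close> fixes the values on a basis of the whole space, hence the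
  matrix.\<close>

definition frame_matrix ::
    "(nat \<Rightarrow> complex ^ 'n::finite) \<Rightarrow> (nat \<Rightarrow> complex ^ 'n) \<Rightarrow> 'n flag \<times> 'n flag \<Rightarrow> nat \<times> nat \<Rightarrow> complex ^ 'n ^ 'n" where
  "frame_matrix b b' q = (SOME A. elementary_on b (frame_vector b' q) A)"

lemma elementary_on_frame_matrix:
  assumes "independent_family {1..d k} b'"
  shows "elementary_on b (frame_vector b' q) (frame_matrix b b' q)"
proof -
  obtain A where "elementary_on b (frame_vector b' q) A"
    using elementary_on_exists[OF independent_frame_vector[OF assms]] by blast
  then show ?thesis unfolding frame_matrix_def by (rule someI[where P = "elementary_on b (frame_vector b' q)"])
qed

text \<open>The frame matrices send frame vectors to constant vectors, which gives holomorphy; the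
  basis property at each point is \<open>E_fibre_basis\<close>.\<close>

lemma local_frame_E:
  fixes b b' :: "nat \<Rightarrow> complex ^ 'n::finite"
  assumes b: "independent_family {1..d k} b" "independent_family {1..d k} b'" and N: "d k = CARD('n)"
    and g: "bij_betw g {..<n} (flag_coords k d)"
  shows "local_frame (E_bundle k d) n (pair_cell b b') (\<lambda>m q. E_map k q (frame_matrix b b' q (g m)))"
  unfolding local_frame_def
proof (intro conjI allI impI ballI)
  fix m assume "m < n"
  obtain r j where rj: "g m = (r, j)" by (cases "g m")
  then have rj_in: "(r, j) \<in> flag_coords k d"
    using g \<open>m < n\<close> unfolding bij_betw_def by (auto simp flip: rj)
  have "frame_matrix b b' q (g m) *v frame_vector b' q j' = (if j' = j then b r else 0)" if "j' \<in> {1..d k}" for j' q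
    using elementary_on_frame_matrix[OF b(2), of b q] rj_in that by (simp add: elementary_on_def rj)
  then have "\<forall>j'\<in>{1..d k}. mfd_holomorphic_vec XX (pair_cell b b')
      (\<lambda>q. frame_matrix b b' q (g m) *v frame_vector b' q j')"
    using mfd_holomorphic_vec_const[OF b N] by simp
  then show "hol_section (E_bundle k d) (pair_cell b b') (\<lambda>q. E_map k q (frame_matrix b b' q (g m)))"
    using b by (intro hol_section_E_map N mfd_open_pair_cell) blast+
next
  fix q assume "q \<in> pair_cell b b'"
  then obtain x where x: "x \<in> pair_domain" "q = pair_param b b' x" by (auto simp: pair_cell_def)
  have "elementary_on b (adapted_vector k d b' (x \<circ> Inr)) (frame_matrix b b' q)"
    using elementary_on_frame_matrix[OF b(2), of b q] x by (simp add: frame_vector_pair_param[OF b(2)])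
  then show "is_basis (fibre (E_bundle k d) q) {..<n} (\<lambda>m. E_map k q (frame_matrix b b' q (g m)))"
    using E_fibre_basis[OF b N g _ x(2)[unfolded pair_param_def]] by (simp add: fibre_E_bundle)
qed

lemma vector_bundle_E:
  assumes N: "d k = CARD('n::finite)" and g: "bij_betw g {..<n} (flag_coords k d)"
  shows "vector_bundle_of_rank (XX :: (_, 'n flag \<times> 'n flag) manifold) (E_bundle k d) n"
  unfolding vector_bundle_of_rank_def points_XX fibre_E_bundle
proof (intro conjI ballI)
  fix p :: "'n flag \<times> 'n flag" assume p: "p \<in> flags k d \<times> flags k d"
  then show "module complex_field (E_fibre k p)"
    by (rule module_image.module_complex_field[OF E_fibre_image[OF _ k_pos]])
  obtain b b' where b: "independent_family {1..d k} b" "independent_family {1..d k} b'" "p \<in> pair_cell b b'"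
    using pair_cell_cover[OF p] by blast
  then show "\<exists>W e. mfd_open XX W \<and> p \<in> W \<and> local_frame (E_bundle k d) n W e"
    using mfd_open_pair_cell[OF b(1,2) N] local_frame_E[OF b(1,2) N g] by blast
qed

text \<open>The identity matrix fixes the frame vectors, and these are holomorphic on every
  cell.\<close>

lemma hol_section_eta:
  assumes N: "d k = CARD('n::finite)"
  shows "hol_section (E_bundle k d) (flags k d \<times> flags k d :: ('n flag \<times> 'n flag) set) (eta k)"
proof -
  have "hol_section (E_bundle k d) (flags k d \<times> flags k d :: ('n flag \<times> 'n flag) set) (\<lambda>q. E_map k q (mat 1))"
  proof (rule hol_section_E_map[OF N mfd_open_points[OF N]])
    fix p :: "'n flag \<times> 'n flag" assume p: "p \<in> flags k d \<times> flags k d"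
    obtain b b' where b: "independent_family {1..d k} b" "independent_family {1..d k} b'" "p \<in> pair_cell b b'"
      using pair_cell_cover[OF p] by blast
    then show "\<exists>b b'. independent_family {1..d k} b \<and> independent_family {1..d k} b' \<and>
      p \<in> pair_cell b b' \<and> pair_cell b b' \<subseteq> flags k d \<times> flags k d \<and>
      (\<forall>j\<in>{1..d k}. mfd_holomorphic_vec XX (pair_cell b b') (\<lambda>q. mat 1 *v frame_vector b' q j))"
      using pair_cell_subset[OF b(1,2) N] mfd_holomorphic_vec_frame_vector[OF b(1,2) N]
      by (intro exI[of _ b] exI[of _ b']) simp
  qed
  then show ?thesis by (simp add: eta_eq_E_map[abs_def])
qed

text \<open>Using one basis \<open>b\<close> in both factors, with \<open>z\<close> at the origin,
  makes the coefficients of \<open>eta\<close> differences of corresponding coordinates. Their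
  derivatives along the second factor form the identity matrix.\<close>

lemma eta_vanishes_to_first_order:
  assumes N: "d k = CARD('n::finite)" and g: "bij_betw g {..<n} (flag_coords k d)"
  shows "vanishes_to_first_order XX (E_bundle k d) n (eta k) (Id_on (flags k d :: 'n flag set))"
  unfolding vanishes_to_first_order_def fibre_E_bundle
proof (intro ballI conjI)
  fix p :: "'n flag \<times> 'n flag" assume "p \<in> Id_on (flags k d)"
  then obtain z where z: "z \<in> flags k d" "p = (z, z)" by auto
  then show "eta k p = \<zero>\<^bsub>E_fibre k p\<^esub>" using eta_diagonal[OF z(1) k_pos] by simp
  obtain b where b: "independent_family {1..d k} b" "flag_param k d b (\<lambda>_. 0) = z"
    using flag_param_surj[OF z(1)] by blast
  let ?\<psi> = "pair_param b b"
  let ?a = "\<lambda>m q. cell_coords b (snd q) (g m) - cell_coords b (fst q) (g m)"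
  let ?C = "flag_coords k d <+> flag_coords k d"
  have a: "(?a m \<circ> ?\<psi>) x = x (Inr (g m)) - x (Inl (g m))" if "x \<in> pair_domain" for m x
    using that b(1) by (simp add: pair_param_def cell_coords_flag_param pair_domain_iff)
  have "eta k q = (\<Oplus>\<^bsub>E_fibre k q\<^esub>m\<in>{..<n}. ?a m q \<odot>\<^bsub>E_fibre k q\<^esub> E_map k q (frame_matrix b b q (g m)))"
    if q: "q \<in> pair_cell b b" for q
  proof -
    obtain x where x: "x \<in> pair_domain" "q = ?\<psi> x" using q by (auto simp: pair_cell_def)
    have "elementary_on b (adapted_vector k d b (x \<circ> Inr)) (frame_matrix b b q)"
      using elementary_on_frame_matrix[OF b(1), of b q] x by (simp add: frame_vector_pair_param[OF b(1)])
    from eta_in_frame[OF b(1) N g this x(2)[unfolded pair_param_def]] show ?thesis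
      using a[OF x(1)] x(2) by simp
  qed
  moreover have "local_param XX pair_domain ?\<psi> (\<lambda>_. 0) p"
    using pair_param_in_params[OF b(1) b(1) N] openin_pair_domain b(2) z(2)
    by (auto simp: local_param_def pair_domain_def coord_space_def pair_param_def o_def)
  moreover have "holomorphic_in_coords ?C pair_domain (?a m \<circ> ?\<psi>)" for m
  proof (subst holomorphic_in_coords_cong[OF a])
    have "openin (top_of_set (coord_space ?C)) pair_domain"
      using openin_pair_domain by (simp add: coords_XX)
    then show "holomorphic_in_coords ?C pair_domain (\<lambda>x. x (Inr (g m)) - x (Inl (g m)))"
      by (intro holomorphic_in_coords_diff holomorphic_in_coords_coordinate)
  qed
  \<comment> \<open>The direction \<open>Inr (g m)\<close> isolates \<open>c m\<close>: along it the
    \<open>m\<close>-th coefficient has derivative 1 and all others have derivative 0.\<close>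
  moreover have "\<forall>m<n. c m = 0"
    if c: "\<forall>i\<in>?C. (\<Sum>m<n. c m * partial_deriv i (?a m \<circ> ?\<psi>) (\<lambda>_. 0)) = 0" for c :: "nat \<Rightarrow> complex"
  proof (intro allI impI)
    fix m assume m: "m < n"
    then have gm: "Inr (g m) \<in> ?C" using g unfolding bij_betw_def by auto
    have "partial_deriv (Inr (g m)) (?a m' \<circ> ?\<psi>) (\<lambda>_. 0) = (if m' = m then 1 else 0)" if "m' < n" for m'
    proof -
      have "(\<lambda>_. 0)(Inr (g m) := t) \<in> pair_domain" for t :: complex
        using gm unfolding pair_domain_def coord_space_def by (auto simp del: InrI)
      then have "(\<lambda>t. (?a m' \<circ> ?\<psi>) ((\<lambda>_. 0)(Inr (g m) := t))) = (\<lambda>t. if g m' = g m then t else 0)"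
        by (auto simp: a simp del: o_apply)
      moreover have "g m' = g m \<longleftrightarrow> m' = m"
        using g m that unfolding bij_betw_def inj_on_def by auto
      ultimately show ?thesis by (simp add: partial_deriv_def)
    qed
    then have "(\<Sum>m'<n. c m' * partial_deriv (Inr (g m)) (?a m' \<circ> ?\<psi>) (\<lambda>_. 0)) = (\<Sum>m'<n. if m' = m then c m' else 0)"
      by (intro sum.cong) auto
    then show "c m = 0" using c gm m by (simp add: sum.delta)
  qed
  ultimately show "\<exists>W e a D \<psi> x. mfd_open XX W \<and> local_frame (E_bundle k d) n W e \<and>
      (\<forall>q\<in>W. eta k q = (\<Oplus>\<^bsub>E_fibre k q\<^esub>m\<in>{..<n}. a m q \<odot>\<^bsub>E_fibre k q\<^esub> e m q)) \<and>
      local_param XX D \<psi> x p \<and> \<psi> ` D \<subseteq> W \<and>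
      (\<forall>m<n. holomorphic_in_coords (coords (XX :: (_, 'n flag \<times> 'n flag) manifold)) D (a m \<circ> \<psi>)) \<and>
      (\<forall>c :: nat \<Rightarrow> complex. (\<forall>i\<in>coords (XX :: (_, 'n flag \<times> 'n flag) manifold). (\<Sum>m<n. c m * partial_deriv i (a m \<circ> \<psi>) x) = 0) \<longrightarrow> (\<forall>m<n. c m = 0))"
    using mfd_open_pair_cell[OF b(1) b(1) N] local_frame_E[OF b(1) b(1) N g]
    unfolding coords_XX
    by (intro exI[of _ "pair_cell b b"] exI[of _ "\<lambda>m q. E_map k q (frame_matrix b b q (g m))"]
        exI[of _ ?a] exI[of _ pair_domain] exI[of _ ?\<psi>] exI[of _ "\<lambda>_. 0"] conjI)
      (blast | simp add: pair_cell_def)+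
qed

end

theorem proposition1:
  fixes k :: nat and d :: "nat \<Rightarrow> nat"
    and X :: "(nat \<times> nat, 'n::finite flag) manifold"
    and E :: "('n flag \<times> 'n flag, nat \<Rightarrow> complex ^ 'n \<Rightarrow> (complex ^ 'n) set) vbundle"
    and n :: nat
  assumes "1 \<le> k" and "0 < d 1" and "\<forall>i\<in>{1..<k}. d i < d (i + 1)" and "d k = CARD('n)"
  defines "X \<equiv> flag_manifold k d"
    and "n \<equiv> mfd_dim X"
    and "E \<equiv> E_bundle k d"
  shows "vector_bundle_of_rank (mfd_prod X X) E n \<and>
    hol_section E (points X \<times> points X) (eta k) \<and>
    vanishes_to_first_order (mfd_prod X X) E n (eta k) (Id_on (points X)) \<and>
    (\<forall>p \<in> points X \<times> points X - Id_on (points X). eta k p \<noteq> \<zero>\<^bsub>fibre E p\<^esub>)"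
proof -
  interpret flag_type k d using assms(1,3) by unfold_locales
  have points: "points X = flags k d" by (simp add: X_def flag_manifold_def)
  have "n = card (flag_coords k d)" by (simp add: n_def X_def mfd_dim_def flag_manifold_def)
  \<comment> \<open>The rank is the number of chart coordinates of one factor; \<open>g\<close>
    numbers them so that they can index a frame.\<close>
  then obtain g where g: "bij_betw g {..<n} (flag_coords k d)"
    using ex_bij_betw_nat_finite[OF finite_flag_coords] by (auto simp: atLeast0LessThan)
  show ?thesis
    unfolding points unfolding X_def E_def fibre_E_bundle
    using vector_bundle_E[OF assms(4) g] hol_section_eta[OF assms(4)]
      eta_vanishes_to_first_order[OF assms(4) g] eta_nonzero[OF _ k_pos]
    by blast
qed

end
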